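(* Let $\mathcal{O}$ be a complete discrete valuation ring with finite residue field and let $n\in\mathbb{N}$. For any $d\in\mathbb{N}$, the number of twist isoclasses of $\mathrm{GL}_n(\mathcal{O})$ of dimension $d$ is finite.
   Context: $\mathbb{N}=\{1,2,\dots\}$. $\mathrm{GL}_n(\mathcal{O})$ carries its profinite topology. Two representations $\rho,\sigma$ of a group $G$ are twist equivalent if there is a one-dimensional representation $\chi$ of $G$ with $\rho\cong\sigma\otimes\chi$. The twist isoclasses considered here are the twist equivalence classes of continuous irreducible complex representations (with $\chi$ continuous); the dimension of a twist isoclass is the common dimension of its members. *)

theory Defs
  imports
    "Jordan_Normal_Form.VS_Connect"
    "HOL-Algebra.Ring_Divisibility"
    "HOL-Algebra.Ideal_Product"
    "HOL-Analysis.Abstract_Topology"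
begin

section \<open>Complete discrete valuation rings\<close>

text \<open>A discrete valuation ring is a local principal ideal domain that is not a field.\<close>

locale discrete_valuation_ring = principal_domain +
  assumes not_field: "\<not> field R"
    and local: "\<exists>!M. maximalideal M R"

text \<open>Only meaningful for local rings.\<close>

definition max_ideal :: "('a, 'b) ring_scheme \<Rightarrow> 'a set" where
  "max_ideal R = (THE M. maximalideal M R)"

definition ideal_power :: "('a, 'b) ring_scheme \<Rightarrow> 'a set \<Rightarrow> nat \<Rightarrow> 'a set" where
  "ideal_power R I k = I [^]\<^bsub>ideals_set R\<^esub> k"

text \<open>Completeness for the topology defined by the powers of an ideal, including separatedness.\<close>

definition adically_complete :: "('a, 'b) ring_scheme \<Rightarrow> 'a set \<Rightarrow> bool" where
  "adically_complete R I \<longleftrightarrow>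
     (\<Inter>k. ideal_power R I k) = {\<zero>\<^bsub>R\<^esub>} \<and>
     (\<forall>x :: nat \<Rightarrow> 'a. range x \<subseteq> carrier R \<longrightarrow>
        (\<forall>k. \<exists>N. \<forall>i\<ge>N. \<forall>j\<ge>N. x i \<ominus>\<^bsub>R\<^esub> x j \<in> ideal_power R I k) \<longrightarrow>
        (\<exists>l\<in>carrier R. \<forall>k. \<exists>N. \<forall>i\<ge>N. x i \<ominus>\<^bsub>R\<^esub> l \<in> ideal_power R I k))"

locale complete_discrete_valuation_ring = discrete_valuation_ring +
  assumes complete: "adically_complete R (max_ideal R)"

section \<open>General linear groups and their profinite topology\<close>

definition GL :: "nat \<Rightarrow> 'a :: comm_ring_1 mat monoid" where
  "GL n = units_of (ring_mat TYPE('a) n ())"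

text \<open>The kernel of \<open>GL\<^sub>n(O) \<rightarrow> GL\<^sub>n(O/\<mm>\<^sup>k)\<close>, where \<open>\<mm>\<close> is the maximal ideal of \<open>O\<close>.\<close>

definition congruence_subgroup :: "nat \<Rightarrow> nat \<Rightarrow> 'a :: comm_ring_1 mat set" where
  "congruence_subgroup n k =
     {g \<in> carrier (GL n). \<forall>i<n. \<forall>j<n.
        (g - 1\<^sub>m n) $$ (i, j) \<in> ideal_power class_ring (max_ideal class_ring) k}"

text \<open>
  The topology of \<open>GL\<^sub>n(O)\<close> as the projective limit of the groups \<open>GL\<^sub>n(O/\<mm>\<^sup>k)\<close>,
  which are finite when the residue field is: the fibres of the projections are the
  cosets of the congruence subgroups.
\<close>

definition GL_topology :: "nat \<Rightarrow> 'a :: comm_ring_1 mat topology" where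
  "GL_topology n =
     topology_generated_by {g <#\<^bsub>GL n\<^esub> congruence_subgroup n k |g k. g \<in> carrier (GL n)}"

section \<open>Representations and twist equivalence\<close>

text \<open>
  A \<open>d\<close>-dimensional complex representation is a homomorphism to \<open>GL\<^sub>d(\<complex>)\<close>. Its values
  outside the carrier of the group are arbitrary and are ignored by all notions below.
  The topology of \<open>GL\<^sub>d(\<complex>)\<close> is that of a subspace of \<open>\<complex>\<close> to the power \<open>d \<times> d\<close>, so
  continuity is continuity of all matrix entries.
\<close>

definition continuous_rep ::
    "('g, 'b) monoid_scheme \<Rightarrow> 'g topology \<Rightarrow> nat \<Rightarrow> ('g \<Rightarrow> complex mat) \<Rightarrow> bool" where
  "continuous_rep G T d \<rho> \<longleftrightarrow>
     \<rho> \<in> hom G (GL d) \<and>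
     (\<forall>i<d. \<forall>j<d. continuous_map T euclidean (\<lambda>g. \<rho> g $$ (i, j)))"

definition irreducible_rep ::
    "('g, 'b) monoid_scheme \<Rightarrow> nat \<Rightarrow> ('g \<Rightarrow> complex mat) \<Rightarrow> bool" where
  "irreducible_rep G d \<rho> \<longleftrightarrow>
     d > 0 \<and>
     (\<forall>W. VectorSpace.subspace class_ring W (module_vec TYPE(complex) d) \<and>
          (\<forall>g\<in>carrier G. \<forall>w\<in>W. \<rho> g *\<^sub>v w \<in> W) \<longrightarrow>
          W = {0\<^sub>v d} \<or> W = carrier_vec d)"

definition rep_iso ::
    "('g, 'b) monoid_scheme \<Rightarrow> nat \<Rightarrow> ('g \<Rightarrow> complex mat) \<Rightarrow> ('g \<Rightarrow> complex mat) \<Rightarrow> bool" where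
  "rep_iso G d \<rho> \<sigma> \<longleftrightarrow>
     (\<exists>P\<in>carrier (GL d). \<forall>g\<in>carrier G. P * \<rho> g = \<sigma> g * P)"

definition kronecker_product :: "'a :: times mat \<Rightarrow> 'a mat \<Rightarrow> 'a mat" where
  "kronecker_product A B =
     mat (dim_row A * dim_row B) (dim_col A * dim_col B)
       (\<lambda>(i, j). A $$ (i div dim_row B, j div dim_col B) * B $$ (i mod dim_row B, j mod dim_col B))"

definition tensor_rep ::
    "('g \<Rightarrow> complex mat) \<Rightarrow> ('g \<Rightarrow> complex mat) \<Rightarrow> 'g \<Rightarrow> complex mat" where
  "tensor_rep \<sigma> \<chi> g = kronecker_product (\<sigma> g) (\<chi> g)"

definition twist_equivalent ::
    "('g, 'b) monoid_scheme \<Rightarrow> 'g topology \<Rightarrow> nat \<Rightarrow>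
     ('g \<Rightarrow> complex mat) \<Rightarrow> ('g \<Rightarrow> complex mat) \<Rightarrow> bool" where
  "twist_equivalent G T d \<rho> \<sigma> \<longleftrightarrow>
     (\<exists>\<chi>. continuous_rep G T 1 \<chi> \<and> rep_iso G d \<rho> (tensor_rep \<sigma> \<chi>))"

definition continuous_irreps ::
    "('g, 'b) monoid_scheme \<Rightarrow> 'g topology \<Rightarrow> nat \<Rightarrow> ('g \<Rightarrow> complex mat) set" where
  "continuous_irreps G T d = {\<rho>. continuous_rep G T d \<rho> \<and> irreducible_rep G d \<rho>}"

definition twist_isoclasses ::
    "('g, 'b) monoid_scheme \<Rightarrow> 'g topology \<Rightarrow> nat \<Rightarrow> ('g \<Rightarrow> complex mat) set set" where
  "twist_isoclasses G T d =
     continuous_irreps G T d //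
       {(\<rho>, \<sigma>). \<rho> \<in> continuous_irreps G T d \<and> \<sigma> \<in> continuous_irreps G T d \<and>
                twist_equivalent G T d \<rho> \<sigma>}"

end

theory Submission
  imports Defs "Jordan_Normal_Form.Char_Poly"
begin

text \<open>
  Let \<open>\<rho>\<close> be a continuous irreducible representation of dimension \<open>d\<close> of \<open>G = GL\<^sub>n(O)\<close>. The point is to find
  a normal subgroup of finite index, depending only on \<open>n\<close>, \<open>d\<close> and \<open>O\<close>, that acts by scalars in every
  such \<open>\<rho>\<close>.

  As \<open>GL\<^sub>d(\<complex>)\<close> has no small subgroups, \<open>\<rho>\<close> is trivial on some congruence subgroup. Thus each root
  subgroup \<open>{1 + c E\<^sub>a\<^sub>b}\<close>, which is a copy of the additive group of \<open>O\<close>, acts through a finite abelian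
  quotient, and its action is a direct sum of at most \<open>d\<close> different characters. Conjugation by a diagonal matrix
  with a single entry \<open>u \<noteq> 1\<close>, where \<open>u\<close> is a unit, permutes these characters by rescaling them; therefore
  \<open>\<rho>\<close> is trivial on all \<open>1 + e c E\<^sub>a\<^sub>b\<close> with \<open>e = u\<^sup>N - 1\<close> and \<open>N = d!\<close> (\<open>elementary_kernel\<close>). The ring \<open>O\<close> is
  an infinite domain and has infinitely many units, so \<open>u\<close> can be chosen with \<open>e \<noteq> 0\<close>. This holds in every
  characteristic.

  Gaussian elimination over the local ring \<open>O\<close> shows that the congruence subgroup \<open>\<Gamma>\<close> of level \<open>e\<close> is
  generated by such elementary matrices and by diagonal matrices, and that \<open>\<Gamma>\<close> is central modulo the
  kernel of \<open>\<rho>\<close> (\<open>level_subgroup_central\<close>). By Schur's lemma it acts by scalars. It has finite index,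
  since \<open>O / e O\<close> is finite.

  So \<open>\<rho>\<close> induces a projective representation of the finite group \<open>G / \<Gamma>\<close>. Normalized to determinant
  \<open>1\<close>, its multiplier has values in the \<open>d\<close>-th roots of unity, and there are only finitely many such
  multipliers (\<open>projective_rep_of_quotient\<close>). For each of them, averaging over the group shows that
  coefficient functions of inequivalent representations are linearly independent, so that there are at most
  \<open>|G / \<Gamma>|\<close> representations up to equivalence (\<open>card_inequivalent_projective_reps\<close>). Finally, two
  continuous representations are twist equivalent if and only if they are projectively equivalent:
  the scalars that relate them form a character, which is locally constant and so continuous
  (\<open>projectively_equivalent_imp_twist_equivalent\<close>).
\<close>

section \<open>Joint eigenvectors of commuting matrices\<close>

lemma mult_mat_zero_vec:
  "A \<in> carrier_mat m d \<Longrightarrow> A *\<^sub>v 0\<^sub>v d = 0\<^sub>v m"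
  by (intro eq_vecI) (auto simp: scalar_prod_def)

lemma mat_eq_zero_if_mult_vec_zero:
  fixes Z :: "'a :: comm_ring_1 mat"
  assumes Z: "Z \<in> carrier_mat m d" and *: "\<And>w. w \<in> carrier_vec d \<Longrightarrow> Z *\<^sub>v w = 0\<^sub>v m"
  shows "Z = 0\<^sub>m m d"
proof (rule eq_matI)
  fix i j assume "i < dim_row (0\<^sub>m m d :: 'a mat)" "j < dim_col (0\<^sub>m m d :: 'a mat)"
  then have ij: "i < m" "j < d" by auto
  then have "Z $$ (i, j) = (Z *\<^sub>v unit_vec d j) $ i" using Z by auto
  also have "\<dots> = 0" using *[of "unit_vec d j"] ij by simp
  finally show "Z $$ (i, j) = 0\<^sub>m m d $$ (i, j)" using ij by simp
qed (use Z in auto)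

text \<open>The linear combination of the vectors \<open>f i\<close> with coefficients \<open>c i\<close>, \<open>i \<in> S\<close>, in dimension \<open>d\<close>.\<close>

definition vec_lincomb :: "nat \<Rightarrow> 'i set \<Rightarrow> ('i \<Rightarrow> 'a) \<Rightarrow> ('i \<Rightarrow> 'a vec) \<Rightarrow> 'a :: comm_ring_1 vec" where
  "vec_lincomb d S c f = vec d (\<lambda>r. \<Sum>i\<in>S. c i * f i $ r)"

lemma vec_lincomb_carrier [simp]: "vec_lincomb d S c f \<in> carrier_vec d"
  by (simp add: vec_lincomb_def)

lemma mult_mat_vec_lincomb:
  assumes A: "A \<in> carrier_mat m d" and f: "\<And>i. i \<in> S \<Longrightarrow> f i \<in> carrier_vec d"
  shows "A *\<^sub>v vec_lincomb d S c f = vec_lincomb m S c (\<lambda>i. A *\<^sub>v f i)"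
proof (rule eq_vecI)
  fix r assume "r < dim_vec (vec_lincomb m S c (\<lambda>i. A *\<^sub>v f i))"
  then have r: "r < m" by (simp add: vec_lincomb_def)
  have dims: "dim_vec (f i) = d" if "i \<in> S" for i using f[OF that] by simp
  have "(A *\<^sub>v vec_lincomb d S c f) $ r = (\<Sum>j<d. A $$ (r, j) * (\<Sum>i\<in>S. c i * f i $ j))"
    using A r by (simp add: vec_lincomb_def scalar_prod_def atLeast0LessThan)
  also have "\<dots> = (\<Sum>i\<in>S. c i * (\<Sum>j<d. A $$ (r, j) * f i $ j))"
    unfolding sum_distrib_left by (subst sum.swap) (simp add: mult_ac)
  also have "\<dots> = (\<Sum>i\<in>S. c i * (A *\<^sub>v f i) $ r)"
    using A r dims by (intro sum.cong) (simp_all add: scalar_prod_def atLeast0LessThan)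
  finally show "(A *\<^sub>v vec_lincomb d S c f) $ r = vec_lincomb m S c (\<lambda>i. A *\<^sub>v f i) $ r"
    using r by (simp add: vec_lincomb_def)
qed (use A in \<open>simp add: vec_lincomb_def\<close>)

lemma vec_lincomb_smult:
  "a \<cdot>\<^sub>v vec_lincomb d S c f = vec_lincomb d S (\<lambda>i. a * c i) f"
  by (auto simp: vec_lincomb_def sum_distrib_left mult_ac)

lemma vec_lincomb_cong:
  "S = S' \<Longrightarrow> (\<And>i r. i \<in> S' \<Longrightarrow> r < d \<Longrightarrow> c i * f i $ r = c' i * f' i $ r) \<Longrightarrow>
    vec_lincomb d S c f = vec_lincomb d S' c' f'"
  by (auto simp: vec_lincomb_def intro!: eq_vecI sum.cong)

text \<open>Any \<open>k + 1\<close> vectors with \<open>k\<close> entries are linearly dependent: pad them to a square matrix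
  with a zero row, whose determinant vanishes.\<close>

lemma linear_dependency:
  fixes f :: "nat \<Rightarrow> nat \<Rightarrow> 'a :: field"
  shows "\<exists>c. (\<exists>t\<le>k. c t \<noteq> 0) \<and> (\<forall>i<k. (\<Sum>t\<le>k. c t * f t i) = 0)"
proof -
  define A where "A = mat (Suc k) (Suc k) (\<lambda>(i, t). if i < k then f t i else 0)"
  have A: "A \<in> carrier_mat (Suc k) (Suc k)" by (simp add: A_def)
  have "det A = 0"
  proof -
    have "det A = (\<Sum>j<Suc k. A $$ (k, j) * cofactor A k j)"
      by (rule laplace_expansion_row[OF A]) simp
    also have "\<dots> = 0" by (rule sum.neutral) (simp add: A_def)
    finally show ?thesis .
  qed
  then obtain v where v: "v \<in> carrier_vec (Suc k)" "v \<noteq> 0\<^sub>v (Suc k)" "A *\<^sub>v v = 0\<^sub>v (Suc k)"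
    using det_0_iff_vec_prod_zero_field[OF A] by auto
  have ex: "\<exists>t\<le>k. v $ t \<noteq> 0"
  proof (rule ccontr)
    assume "\<not> ?thesis"
    then have "v = 0\<^sub>v (Suc k)" using v(1) by (intro eq_vecI) auto
    then show False using v(2) by simp
  qed
  have "(\<Sum>t\<le>k. v $ t * f t i) = 0" if "i < k" for i
  proof -
    have "(A *\<^sub>v v) $ i = (\<Sum>t\<le>k. A $$ (i, t) * v $ t)"
      using v(1) that A by (simp add: scalar_prod_def atLeast0LessThan lessThan_Suc_atMost)
    also have "\<dots> = (\<Sum>t\<le>k. v $ t * f t i)"
      using that by (intro sum.cong) (auto simp: A_def)
    finally show ?thesis using v(3) that by simp
  qed
  with ex show ?thesis by (intro exI[of _ "\<lambda>t. v $ t"]) auto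
qed

text \<open>A nonzero common eigenvector of all matrices in \<open>\<B>\<close>.\<close>

definition joint_eigenvector :: "nat \<Rightarrow> 'a :: field mat set \<Rightarrow> 'a vec \<Rightarrow> bool" where
  "joint_eigenvector d \<B> w \<longleftrightarrow>
     w \<in> carrier_vec d \<and> w \<noteq> 0\<^sub>v d \<and> (\<forall>B\<in>\<B>. \<exists>c. B *\<^sub>v w = c \<cdot>\<^sub>v w)"

lemma sum_powers_root_of_unity:
  fixes z :: "'a :: field"
  assumes "z ^ m = 1" and "z \<noteq> 1"
  shows "(\<Sum>k<m. z ^ k) = 0"
  using assms by (simp add: geometric_sum)

text \<open>If \<open>B\<close> has order dividing \<open>m\<close>, these averages over its powers are, up to the factor \<open>m\<close>, the
  projections of \<open>w\<close> to the eigenspaces of \<open>B\<close>.\<close>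

lemma finite_order_eigenprojection:
  fixes B :: "'a :: field mat"
  assumes B: "B \<in> carrier_mat d d" and pow: "B ^\<^sub>m m = 1\<^sub>m d" and w: "w \<in> carrier_vec d"
    and \<eta>: "\<eta> ^ m = 1" and m: "m > 0"
  defines "w' \<equiv> vec_lincomb d {..<m} (\<lambda>i. \<eta> ^ i) (\<lambda>i. B ^\<^sub>m i *\<^sub>v w)"
  shows "B *\<^sub>v w' = inverse \<eta> \<cdot>\<^sub>v w'"
proof -
  have \<eta>0: "\<eta> \<noteq> 0" using \<eta> m by (cases "\<eta> = 0") (auto simp: power_0_left)
  have Bi: "B ^\<^sub>m i \<in> carrier_mat d d" for i using B by (simp add: pow_carrier_mat)
  have step: "B *\<^sub>v (B ^\<^sub>m i *\<^sub>v w) = B ^\<^sub>m Suc i *\<^sub>v w" for i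
  proof -
    have "B * B ^\<^sub>m i = B ^\<^sub>m Suc i"
      by (induction i) (use B Bi in \<open>auto simp flip: assoc_mult_mat[of _ d d _ d _ d]\<close>)
    then show ?thesis using B Bi w by (metis assoc_mult_mat_vec)
  qed
  have "\<eta> \<cdot>\<^sub>v (B *\<^sub>v w') = vec_lincomb d {..<m} (\<lambda>i. \<eta> ^ Suc i) (\<lambda>i. B ^\<^sub>m Suc i *\<^sub>v w)"
    unfolding w'_def using B Bi w
    by (subst mult_mat_vec_lincomb[of _ d d]) (auto simp: vec_lincomb_smult step[simplified] intro!: mult_mat_vec_carrier)
  also have "\<dots> = w'"
  proof (rule eq_vecI)
    fix r assume "r < dim_vec w'"
    then have r: "r < d" by (simp add: w'_def vec_lincomb_def)
    define g where "g i = \<eta> ^ i * (B ^\<^sub>m i *\<^sub>v w) $ r" for i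
    have "g m = g 0" using B pow w \<eta> by (simp add: g_def)
    moreover have "(\<Sum>i<Suc m. g i) = g 0 + (\<Sum>i<m. g (Suc i))" by (rule sum.lessThan_Suc_shift)
    ultimately have "(\<Sum>i<m. g (Suc i)) = (\<Sum>i<m. g i)" by simp
    then show "vec_lincomb d {..<m} (\<lambda>i. \<eta> ^ Suc i) (\<lambda>i. B ^\<^sub>m Suc i *\<^sub>v w) $ r = w' $ r"
      using r unfolding w'_def g_def vec_lincomb_def by simp
  qed (simp add: w'_def vec_lincomb_def)
  finally have "inverse \<eta> \<cdot>\<^sub>v (\<eta> \<cdot>\<^sub>v (B *\<^sub>v w')) = inverse \<eta> \<cdot>\<^sub>v w'" by simp
  then show ?thesis using \<eta>0 by (simp add: smult_smult_assoc)
qed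

text \<open>Commuting complex matrices of finite order are simultaneously diagonalizable. This is expressed
  without bases or direct sums: a matrix that annihilates all joint eigenvectors is zero.\<close>

lemma mat_eq_zero_if_kills_joint_eigenvectors:
  fixes Z :: "complex mat"
  assumes fin: "finite \<B>" and car: "\<B> \<subseteq> carrier_mat d d"
    and comm: "\<And>A B. A \<in> \<B> \<Longrightarrow> B \<in> \<B> \<Longrightarrow> A * B = B * A"
    and ord: "\<And>B. B \<in> \<B> \<Longrightarrow> \<exists>m>0. B ^\<^sub>m m = 1\<^sub>m d"
    and Z: "Z \<in> carrier_mat d d"
    and kill: "\<And>w. joint_eigenvector d \<B> w \<Longrightarrow> Z *\<^sub>v w = 0\<^sub>v d"
  shows "Z = 0\<^sub>m d d"
  using fin car comm ord kill
proof (induction \<B>)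
  case empty
  have *: "Z *\<^sub>v w = 0\<^sub>v d" if "w \<in> carrier_vec d" for w
  proof (cases "w = 0\<^sub>v d")
    case True then show ?thesis using Z by auto
  next
    case False then show ?thesis using that empty.prems(4) by (simp add: joint_eigenvector_def)
  qed
  show ?case by (rule mat_eq_zero_if_mult_vec_zero[OF Z *])
next
  case (insert B \<B>)
  have B: "B \<in> carrier_mat d d" using insert.prems by auto
  obtain m where m: "m > 0" "B ^\<^sub>m m = 1\<^sub>m d" using insert.prems(3)[of B] by auto
  have Bi: "B ^\<^sub>m i \<in> carrier_mat d d" for i using B by (simp add: pow_carrier_mat)
  define \<zeta> where "\<zeta> = cis (2 * pi / m)"
  have \<zeta>m: "\<zeta> ^ m = 1" using m by (simp add: \<zeta>_def DeMoivre)
  have \<zeta>i: "\<zeta> ^ i \<noteq> 1" if "0 < i" "i < m" for i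
  proof -
    have "\<zeta> ^ i = cis (2 * pi * real i / real m)"
      by (simp add: \<zeta>_def DeMoivre mult_ac)
    moreover have "cis (2 * pi * real i / real m) \<noteq> cis (2 * pi * real 0 / real m)"
    proof -
      have "inj_on (\<lambda>k. cis (2 * pi * real k / real m)) {..<m}"
        using bij_betw_roots_unity[of m] m(1) by (simp add: bij_betw_def)
      from inj_on_eq_iff[OF this, of i 0] show ?thesis using that by simp
    qed
    ultimately show ?thesis by simp
  qed
  show ?case
  proof (rule insert.IH)
    fix w assume w: "joint_eigenvector d \<B> w"
    then have wc: "w \<in> carrier_vec d" by (simp add: joint_eigenvector_def)
    define W where "W k = vec_lincomb d {..<m} (\<lambda>i. (\<zeta> ^ k) ^ i) (\<lambda>i. B ^\<^sub>m i *\<^sub>v w)" for k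
    have ZW: "Z *\<^sub>v W k = 0\<^sub>v d" for k
    proof (cases "W k = 0\<^sub>v d")
      case True then show ?thesis using Z by auto
    next
      case False
      have "B *\<^sub>v W k = inverse (\<zeta> ^ k) \<cdot>\<^sub>v W k"
        unfolding W_def
      proof (rule finite_order_eigenprojection[OF B m(2) wc _ m(1)])
        show "(\<zeta> ^ k) ^ m = 1" using \<zeta>m by (metis mult.commute power_mult power_one)
      qed
      moreover have "\<exists>c. A *\<^sub>v W k = c \<cdot>\<^sub>v W k" if A: "A \<in> \<B>" for A
      proof -
        obtain c where c: "A *\<^sub>v w = c \<cdot>\<^sub>v w" using w A by (auto simp: joint_eigenvector_def)
        have Ac: "A \<in> carrier_mat d d" using insert.prems A by auto
        have AB: "A * B = B * A" using insert.prems(2)[of A B] A by auto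
        have ABi: "A * B ^\<^sub>m i = B ^\<^sub>m i * A" for i
        proof (induction i)
          case (Suc i)
          have "A * B ^\<^sub>m Suc i = (A * B ^\<^sub>m i) * B" using Ac Bi B by (simp add: assoc_mult_mat[of _ d d _ d _ d])
          also have "\<dots> = B ^\<^sub>m i * (A * B)" using Ac Bi B Suc by (simp add: assoc_mult_mat[of _ d d _ d _ d])
          also have "\<dots> = B ^\<^sub>m Suc i * A" using Ac Bi B AB by (simp add: assoc_mult_mat[of _ d d _ d _ d])
          finally show ?case .
        qed (use Ac B in auto)
        have "A *\<^sub>v (B ^\<^sub>m i *\<^sub>v w) = c \<cdot>\<^sub>v (B ^\<^sub>m i *\<^sub>v w)" for i
        proof -
          have "A *\<^sub>v (B ^\<^sub>m i *\<^sub>v w) = B ^\<^sub>m i *\<^sub>v (A *\<^sub>v w)"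
            using Ac Bi wc ABi by (metis assoc_mult_mat_vec)
          then show ?thesis using c mult_mat_vec[OF Bi wc] by simp
        qed
        then have "A *\<^sub>v W k = vec_lincomb d {..<m} (\<lambda>i. (\<zeta> ^ k) ^ i) (\<lambda>i. c \<cdot>\<^sub>v (B ^\<^sub>m i *\<^sub>v w))"
          unfolding W_def using Ac mult_mat_vec_carrier[OF Bi wc]
            by (subst mult_mat_vec_lincomb[of _ d d]) auto
        also have "\<dots> = c \<cdot>\<^sub>v W k" unfolding W_def using Bi B wc
          by (subst vec_lincomb_smult) (auto intro!: vec_lincomb_cong)
        finally show ?thesis by blast
      qed
      ultimately have "joint_eigenvector d (insert B \<B>) (W k)"
        using False by (auto simp: joint_eigenvector_def W_def)
      then show ?thesis by (rule insert.prems(4))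
    qed
    \<comment> \<open>The sum of the roots of unity \<open>\<zeta>\<^sup>i\<^sup>k\<close> over \<open>k\<close> vanishes unless \<open>i = 0\<close>.\<close>
    have "vec_lincomb d {..<m} (\<lambda>_. 1) W = of_nat m \<cdot>\<^sub>v w"
    proof (rule eq_vecI)
      fix r assume "r < dim_vec (of_nat m \<cdot>\<^sub>v w)"
      then have r: "r < d" using wc by simp
      define h where "h i = (B ^\<^sub>m i *\<^sub>v w) $ r" for i
      have "(\<Sum>k<m. W k $ r) = (\<Sum>k<m. \<Sum>i<m. (\<zeta> ^ i) ^ k * h i)"
        using r by (simp add: W_def vec_lincomb_def h_def mult.commute[of k i for k i] flip: power_mult)
      also have "\<dots> = (\<Sum>i<m. (\<Sum>k<m. (\<zeta> ^ i) ^ k) * h i)"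
        by (subst sum.swap) (simp add: sum_distrib_right)
      also have "\<dots> = (\<Sum>i<m. (if i = 0 then of_nat m else 0) * h i)"
      proof (rule sum.cong)
        fix i assume i: "i \<in> {..<m}"
        have "(\<Sum>k<m. (\<zeta> ^ i) ^ k) = (if i = 0 then of_nat m else 0)"
        proof (cases "i = 0")
          case False
          have "(\<zeta> ^ i) ^ m = 1" using \<zeta>m by (metis mult.commute power_mult power_one)
          then show ?thesis using sum_powers_root_of_unity[of "\<zeta> ^ i" m] \<zeta>i[of i] i False by simp
        qed simp
        then show "(\<Sum>k<m. (\<zeta> ^ i) ^ k) * h i = (if i = 0 then of_nat m else 0) * h i" by simp
      qed simp
      also have "\<dots> = of_nat m * w $ r"
        using m wc B r by (simp add: if_distrib[of "\<lambda>x. x * _"] sum.delta h_def cong: if_cong)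
      finally show "vec_lincomb d {..<m} (\<lambda>_. 1) W $ r = (of_nat m \<cdot>\<^sub>v w) $ r"
        using r wc by (simp add: vec_lincomb_def)
    qed (use wc in \<open>simp add: vec_lincomb_def\<close>)
    then have "Z *\<^sub>v (of_nat m \<cdot>\<^sub>v w) = vec_lincomb d {..<m} (\<lambda>_. 1) (\<lambda>k. Z *\<^sub>v W k)"
      using Z by (subst mult_mat_vec_lincomb[symmetric, of _ d d]) (auto simp: W_def)
    also have "\<dots> = 0\<^sub>v d" by (auto simp: ZW vec_lincomb_def)
    finally have "of_nat m \<cdot>\<^sub>v (Z *\<^sub>v w) = 0\<^sub>v d"
      using mult_mat_vec[OF Z wc] by simp
    then have "inverse (of_nat m) \<cdot>\<^sub>v (of_nat m \<cdot>\<^sub>v (Z *\<^sub>v w)) = inverse (of_nat m) \<cdot>\<^sub>v 0\<^sub>v d"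
      by simp
    also have "inverse (of_nat m) \<cdot>\<^sub>v 0\<^sub>v d = (0\<^sub>v d :: complex vec)" by auto
    finally show "Z *\<^sub>v w = 0\<^sub>v d" using m Z by (simp add: smult_smult_assoc)
  qed (use insert.prems in auto)
qed

lemma independent_if_distinct_weights:
  fixes w :: "'i \<Rightarrow> 'b :: field vec"
  assumes B: "\<And>a. B a \<in> carrier_mat d d"
    and w: "\<And>t. t \<in> S \<Longrightarrow> w t \<in> carrier_vec d" "\<And>t. t \<in> S \<Longrightarrow> w t \<noteq> 0\<^sub>v d"
    and eig: "\<And>t a. t \<in> S \<Longrightarrow> B a *\<^sub>v w t = \<psi> t a \<cdot>\<^sub>v w t"
    and inj: "inj_on \<psi> S" and fin: "finite S"
    and zero: "vec_lincomb d S c w = 0\<^sub>v d" and t: "t \<in> S"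
  shows "c t = 0"
  using fin w eig inj zero t
proof (induction S arbitrary: c t)
  case (insert s S)
  have sum0: "(\<Sum>i\<in>insert s S. c i * w i $ r) = 0" if "r < d" for r
    using arg_cong[OF insert.prems(5), of "\<lambda>v. v $ r"] that by (simp add: vec_lincomb_def)
  have vs: "c t = 0" if t: "t \<in> S" for t
  proof -
    have "\<psi> s \<noteq> \<psi> t" using insert.prems(4) insert.hyps t by (auto simp: inj_on_def)
    then obtain a where a: "\<psi> s a \<noteq> \<psi> t a" by auto
    \<comment> \<open>Applying \<open>B a - \<psi> s a\<close> to the relation removes the vector \<open>w s\<close>.\<close>
    have "vec_lincomb d S (\<lambda>i. c i * (\<psi> i a - \<psi> s a)) w = 0\<^sub>v d"
    proof (rule eq_vecI)
      fix r assume "r < dim_vec (0\<^sub>v d :: 'b vec)"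
      then have r: "r < d" by simp
      have "vec_lincomb d (insert s S) c (\<lambda>i. B a *\<^sub>v w i) = 0\<^sub>v d"
        using mult_mat_vec_lincomb[OF B[of a], of "insert s S" w c] insert.prems(1) insert.prems(5)
        by (simp add: mult_mat_zero_vec[OF B[of a]])
      from arg_cong[OF this, of "\<lambda>v. v $ r"]
      have "(\<Sum>i\<in>insert s S. c i * (B a *\<^sub>v w i) $ r) = 0" using r by (simp add: vec_lincomb_def)
      also have "(\<Sum>i\<in>insert s S. c i * (B a *\<^sub>v w i) $ r) = (\<Sum>i\<in>insert s S. c i * \<psi> i a * w i $ r)"
      proof (rule sum.cong)
        fix i assume i: "i \<in> insert s S"
        have "dim_vec (w i) = d" using insert.prems(1)[OF i] by simp
        then show "c i * (B a *\<^sub>v w i) $ r = c i * \<psi> i a * w i $ r"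
          using insert.prems(3)[OF i, of a] r by simp
      qed simp
      finally have 1: "(\<Sum>i\<in>insert s S. c i * \<psi> i a * w i $ r) = 0" .
      have "(\<Sum>i\<in>insert s S. c i * (\<psi> i a - \<psi> s a) * w i $ r) =
          (\<Sum>i\<in>insert s S. c i * \<psi> i a * w i $ r) - \<psi> s a * (\<Sum>i\<in>insert s S. c i * w i $ r)"
        unfolding sum_distrib_left sum_subtractf[symmetric] by (rule sum.cong) (auto simp: algebra_simps)
      also have "\<dots> = 0" using 1 sum0[OF r] by simp
      finally show "vec_lincomb d S (\<lambda>i. c i * (\<psi> i a - \<psi> s a)) w $ r = 0\<^sub>v d $ r"
        using insert.hyps r by (simp add: vec_lincomb_def)
    qed (simp add: vec_lincomb_def)
    then have "c t * (\<psi> t a - \<psi> s a) = 0"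
      using insert.prems t by (intro insert.IH) (auto simp: inj_on_def)
    then show ?thesis using a by auto
  qed
  have "c s = 0"
  proof (rule ccontr)
    assume cs: "c s \<noteq> 0"
    have "w s $ r = 0" if "r < d" for r
      using sum0[OF that] insert.hyps vs cs by simp
    then have "w s = 0\<^sub>v d" using insert.prems(1)[of s] by (intro eq_vecI) auto
    then show False using insert.prems(2)[of s] by simp
  qed
  then show ?case using vs insert.prems(6) by auto
qed simp

text \<open>Joint eigenvectors with distinct weights are independent, so that \<open>d + 1\<close> of them cannot all
  have distinct weights.\<close>

lemma joint_weights_repeat:
  fixes w :: "nat \<Rightarrow> 'b :: field vec"
  assumes B: "\<And>a. B a \<in> carrier_mat d d"
    and w: "\<And>t. w t \<in> carrier_vec d" "\<And>t. w t \<noteq> 0\<^sub>v d"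
    and eig: "\<And>t a. B a *\<^sub>v w t = \<psi> t a \<cdot>\<^sub>v w t"
  shows "\<exists>s t. s < t \<and> t \<le> d \<and> \<psi> s = \<psi> t"
proof -
  obtain c where c: "\<exists>t\<le>d. c t \<noteq> 0" "\<And>i. i < d \<Longrightarrow> (\<Sum>t\<le>d. c t * w t $ i) = 0"
    using linear_dependency[of d "\<lambda>t i. w t $ i"] by auto
  have "vec_lincomb d {..d} c w = 0\<^sub>v d" using c(2) by (auto simp: vec_lincomb_def)
  then have "\<not> inj_on \<psi> {..d}"
    using independent_if_distinct_weights[of B d "{..d}" w \<psi> c] assms c(1) by blast
  then obtain s t where "s \<le> d" "t \<le> d" "s \<noteq> t" "\<psi> s = \<psi> t" by (auto simp: inj_on_def)
  then show ?thesis by (metis linorder_neqE_nat)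
qed

section \<open>Schur's lemma and projective representations of finite groups\<close>

lemma subspaceI_vec:
  fixes W :: "'a :: field vec set"
  assumes "W \<subseteq> carrier_vec d" "0\<^sub>v d \<in> W"
    and "\<And>v w. v \<in> W \<Longrightarrow> w \<in> W \<Longrightarrow> v + w \<in> W" "\<And>c v. v \<in> W \<Longrightarrow> c \<cdot>\<^sub>v v \<in> W"
  shows "VectorSpace.subspace class_ring W (module_vec TYPE('a) d)"
  unfolding VectorSpace.subspace_def submodule_def
  using vec_vs[where ?'a = 'a and n = d] vec_module[where ?'a = 'a and n = d] assms
  by (simp add: module_vec_simps)

lemma subspace_smult_closed:
  fixes W :: "'a :: field vec set"
  assumes "VectorSpace.subspace class_ring W (module_vec TYPE('a) d)" "v \<in> W"
  shows "c \<cdot>\<^sub>v v \<in> W"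
  using assms unfolding VectorSpace.subspace_def submodule_def by (simp add: module_vec_simps)

lemma subspace_carrier:
  fixes W :: "'a :: field vec set"
  assumes "VectorSpace.subspace class_ring W (module_vec TYPE('a) d)"
  shows "W \<subseteq> carrier_vec d"
  using assms unfolding VectorSpace.subspace_def submodule_def by (simp add: module_vec_simps)

text \<open>Schur's lemma. The matrices \<open>B\<close> need not form a representation: already \<open>P * \<rho> g = B * P\<close>
  makes the kernel of \<open>P\<close> invariant. The function \<open>\<rho>\<close> need not be a homomorphism either, which allows
  projective representations.\<close>

lemma schur_zero_or_invertible:
  assumes irr: "irreducible_rep G d \<rho>"
    and \<rho>: "\<And>g. g \<in> carrier G \<Longrightarrow> \<rho> g \<in> carrier_mat d d"
    and P: "P \<in> carrier_mat d d"
    and intertwine: "\<And>g. g \<in> carrier G \<Longrightarrow> \<exists>B\<in>carrier_mat d d. P * \<rho> g = B * P"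
  shows "P = 0\<^sub>m d d \<or> det P \<noteq> 0"
proof -
  define W where "W = {v \<in> carrier_vec d. P *\<^sub>v v = 0\<^sub>v d}"
  have sub: "VectorSpace.subspace class_ring W (module_vec TYPE(complex) d)"
  proof (rule subspaceI_vec)
    fix v w assume "v \<in> W" "w \<in> W"
    then show "v + w \<in> W" using P by (auto simp: W_def mult_add_distrib_mat_vec)
  next
    fix c v assume "v \<in> W"
    moreover have "c \<cdot>\<^sub>v 0\<^sub>v d = (0\<^sub>v d :: complex vec)" by auto
    ultimately show "c \<cdot>\<^sub>v v \<in> W" using P by (simp add: W_def mult_mat_vec)
  qed (use P in \<open>auto simp: W_def mult_mat_zero_vec\<close>)
  have inv: "\<rho> g *\<^sub>v w \<in> W" if g: "g \<in> carrier G" and w: "w \<in> W" for g w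
  proof -
    obtain B where B: "B \<in> carrier_mat d d" "P * \<rho> g = B * P" using intertwine[OF g] by auto
    have wc: "w \<in> carrier_vec d" "P *\<^sub>v w = 0\<^sub>v d" using w by (auto simp: W_def)
    have "P *\<^sub>v (\<rho> g *\<^sub>v w) = B *\<^sub>v (P *\<^sub>v w)"
      using assoc_mult_mat_vec[OF P \<rho>[OF g] wc(1)] assoc_mult_mat_vec[OF B(1) P wc(1)] B(2) by simp
    then show ?thesis
      using wc mult_mat_zero_vec[OF B(1)] \<rho>[OF g] by (auto simp: W_def intro!: mult_mat_vec_carrier)
  qed
  have "W = {0\<^sub>v d} \<or> W = carrier_vec d"
    using irr sub inv unfolding irreducible_rep_def by blast
  then show ?thesis
  proof
    assume "W = {0\<^sub>v d}"
    then show ?thesis using det_0_iff_vec_prod_zero_field[OF P] by (auto simp: W_def)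
  next
    assume "W = carrier_vec d"
    then have "\<And>v. v \<in> carrier_vec d \<Longrightarrow> P *\<^sub>v v = 0\<^sub>v d" by (auto simp: W_def)
    then show ?thesis using mat_eq_zero_if_mult_vec_zero[OF P] by blast
  qed
qed

lemma complex_eigenvalue_exists:
  fixes A :: "complex mat"
  assumes A: "A \<in> carrier_mat d d" and d: "d > 0"
  shows "\<exists>k. det (A - k \<cdot>\<^sub>m 1\<^sub>m d) = 0"
proof -
  have "degree (char_poly A) = d" by (simp add: degree_monic_char_poly[OF A])
  then have "\<not> constant (poly (char_poly A))" using d by (simp add: constant_degree)
  then obtain k where "poly (char_poly A) k = 0" using fundamental_theorem_of_algebra by blast
  then have "eigenvalue A k" using eigenvalue_root_char_poly[OF A] by simp
  then have "det (char_matrix A k) = 0" using eigenvalue_det[OF A] by simp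
  moreover have "char_matrix A k = A - k \<cdot>\<^sub>m 1\<^sub>m d"
    using A by (intro eq_matI) (auto simp: char_matrix_def)
  ultimately show ?thesis by auto
qed

lemma schur_scalar:
  assumes irr: "irreducible_rep G d \<rho>"
    and \<rho>: "\<And>g. g \<in> carrier G \<Longrightarrow> \<rho> g \<in> carrier_mat d d"
    and C: "C \<in> carrier_mat d d"
    and comm: "\<And>g. g \<in> carrier G \<Longrightarrow> C * \<rho> g = \<rho> g * C"
  shows "\<exists>k. C = k \<cdot>\<^sub>m 1\<^sub>m d"
proof -
  have d: "d > 0" using irr by (simp add: irreducible_rep_def)
  obtain k where k: "det (C - k \<cdot>\<^sub>m 1\<^sub>m d) = 0" using complex_eigenvalue_exists[OF C d] by blast
  have Ck: "C - k \<cdot>\<^sub>m 1\<^sub>m d \<in> carrier_mat d d" by (rule minus_carrier_mat) simp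
  have comm': "(C - k \<cdot>\<^sub>m 1\<^sub>m d) * \<rho> g = \<rho> g * (C - k \<cdot>\<^sub>m 1\<^sub>m d)" if "g \<in> carrier G" for g
    using \<rho>[OF that] C comm[OF that]
    by (simp add: minus_mult_distrib_mat[of _ d d _ _ d] mult_minus_distrib_mat[of _ d d _ d]
        mult_smult_distrib[of _ d d _ d] mult_smult_assoc_mat[of _ d d _ d])
  have zero: "C - k \<cdot>\<^sub>m 1\<^sub>m d = 0\<^sub>m d d"
    using schur_zero_or_invertible[OF irr \<rho> Ck] comm' \<rho> k by blast
  have "C = k \<cdot>\<^sub>m 1\<^sub>m d"
  proof (rule eq_matI)
    fix i j assume "i < dim_row (k \<cdot>\<^sub>m 1\<^sub>m d)" "j < dim_col (k \<cdot>\<^sub>m 1\<^sub>m d)"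
    then have ij: "i < d" "j < d" by auto
    then have "(C - k \<cdot>\<^sub>m 1\<^sub>m d) $$ (i, j) = 0" unfolding zero by simp
    then show "C $$ (i, j) = (k \<cdot>\<^sub>m 1\<^sub>m d) $$ (i, j)" using ij C by simp
  qed (use C in auto)
  then show ?thesis ..
qed

text \<open>A projective representation of \<open>F\<close> with the given multiplier \<open>\<alpha>\<close>.\<close>

definition projective_rep ::
    "('g, 'b) monoid_scheme \<Rightarrow> nat \<Rightarrow> ('g \<Rightarrow> 'g \<Rightarrow> complex) \<Rightarrow> ('g \<Rightarrow> complex mat) \<Rightarrow> bool" where
  "projective_rep F d \<alpha> T \<longleftrightarrow>
     (\<forall>p\<in>carrier F. T p \<in> carrier_mat d d \<and> det (T p) \<noteq> 0) \<and>
     (\<forall>p\<in>carrier F. \<forall>q\<in>carrier F. T p * T q = \<alpha> p q \<cdot>\<^sub>m T (p \<otimes>\<^bsub>F\<^esub> q))"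

lemma obtain_inverse_mat:
  assumes "A \<in> carrier_mat d d" "det (A :: 'a :: field mat) \<noteq> 0"
  obtains B where "B \<in> carrier_mat d d" "A * B = 1\<^sub>m d" "B * A = 1\<^sub>m d"
  using det_non_zero_imp_unit[OF assms, of "()"] unfolding Units_def ring_mat_def by auto

text \<open>For two projective representations \<open>T\<close> and \<open>S\<close> with the same multiplier, the average of
  \<open>S(g)\<^sup>-\<^sup>1 X T(g)\<close> over \<open>g\<close> intertwines \<open>T\<close> and \<open>S\<close>, because the multipliers cancel. Here \<open>X\<close> is the matrix
  unit at \<open>(0, 0)\<close>, and \<open>U g\<close> stands for the inverse of \<open>S g\<close>.\<close>

lemma projective_schur_averages:
  assumes F: "group F" "finite (carrier F)"
    and T: "projective_rep F d \<alpha> T" and S: "projective_rep F d \<alpha> S"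
    and irr: "irreducible_rep F d T"
    and U: "\<And>p. p \<in> carrier F \<Longrightarrow> U p \<in> carrier_mat d d \<and> S p * U p = 1\<^sub>m d \<and> U p * S p = 1\<^sub>m d"
  defines "\<Phi> \<equiv> mat d d (\<lambda>(i, j). \<Sum>g\<in>carrier F. U g $$ (i, 0) * T g $$ (0, j))"
  shows "\<Phi> \<in> carrier_mat d d" and "p \<in> carrier F \<Longrightarrow> \<Phi> * T p = S p * \<Phi>"
    and "\<Phi> = 0\<^sub>m d d \<or> det \<Phi> \<noteq> 0"
proof -
  interpret F: group F by (rule F)
  have d: "d > 0" using irr by (simp add: irreducible_rep_def)
  show \<Phi>: "\<Phi> \<in> carrier_mat d d" by (simp add: \<Phi>_def)
  have Tc: "T p \<in> carrier_mat d d" and Sc: "S p \<in> carrier_mat d d" if "p \<in> carrier F" for p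
    using T S that by (auto simp: projective_rep_def)
  show comm: "\<Phi> * T p = S p * \<Phi>" if p: "p \<in> carrier F" for p
  proof (rule eq_matI)
    fix i j assume "i < dim_row (S p * \<Phi>)" "j < dim_col (S p * \<Phi>)"
    then have ij: "i < d" "j < d" using Sc[OF p] \<Phi> by auto
    have eq: "U g $$ (i, 0) * (\<Sum>k<d. T g $$ (0, k) * T p $$ (k, j)) =
        (\<Sum>k<d. S p $$ (i, k) * U (g \<otimes>\<^bsub>F\<^esub> p) $$ (k, 0)) * T (g \<otimes>\<^bsub>F\<^esub> p) $$ (0, j)"
      if g: "g \<in> carrier F" for g
    proof -
      let ?gp = "g \<otimes>\<^bsub>F\<^esub> p"
      have gp: "?gp \<in> carrier F" using g p by simp
      have "(\<Sum>k<d. T g $$ (0, k) * T p $$ (k, j)) = (T g * T p) $$ (0, j)"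
        using Tc[OF g] Tc[OF p] ij d by (simp add: scalar_prod_def atLeast0LessThan)
      also have "\<dots> = \<alpha> g p * T ?gp $$ (0, j)"
        using T g p carrier_matD[OF Tc[OF gp]] ij d by (simp add: projective_rep_def)
      finally have 1: "(\<Sum>k<d. T g $$ (0, k) * T p $$ (k, j)) = \<alpha> g p * T ?gp $$ (0, j)" .
      have "S p * U ?gp = U g * (S g * S p) * U ?gp"
        using U[OF g] U[OF gp] Sc[OF g] Sc[OF p] by (simp flip: assoc_mult_mat[of _ d d _ d _ d])
      also have "S g * S p = \<alpha> g p \<cdot>\<^sub>m S ?gp" using S g p by (simp add: projective_rep_def)
      also have "U g * (\<alpha> g p \<cdot>\<^sub>m S ?gp) * U ?gp = \<alpha> g p \<cdot>\<^sub>m (U g * (S ?gp * U ?gp))"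
        using U[OF g] U[OF gp] Sc[OF gp]
        by (simp add: mult_smult_distrib[of _ d d _ d] mult_smult_assoc_mat[of _ d d _ d]
            assoc_mult_mat[of _ d d _ d _ d] mult_carrier_mat[of _ d d _ d])
      also have "\<dots> = \<alpha> g p \<cdot>\<^sub>m U g"
        using U[OF g] U[OF gp] by (simp add: right_mult_one_mat[of _ d d])
      finally have 2: "S p * U ?gp = \<alpha> g p \<cdot>\<^sub>m U g" .
      have "(\<Sum>k<d. S p $$ (i, k) * U ?gp $$ (k, 0)) = (S p * U ?gp) $$ (i, 0)"
        using Sc[OF p] conjunct1[OF U[OF gp]] ij d by (simp add: scalar_prod_def atLeast0LessThan)
      also have "\<dots> = \<alpha> g p * U g $$ (i, 0)" unfolding 2 using conjunct1[OF U[OF g]] ij d by auto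
      finally show ?thesis using 1 by simp
    qed
    have "(\<Phi> * T p) $$ (i, j) = (\<Sum>k<d. (\<Sum>g\<in>carrier F. U g $$ (i, 0) * T g $$ (0, k)) * T p $$ (k, j))"
      using Tc[OF p] ij \<Phi> by (simp add: scalar_prod_def atLeast0LessThan \<Phi>_def)
    also have "\<dots> = (\<Sum>g\<in>carrier F. U g $$ (i, 0) * (\<Sum>k<d. T g $$ (0, k) * T p $$ (k, j)))"
      unfolding sum_distrib_left sum_distrib_right by (subst sum.swap) (simp add: mult_ac)
    also have "\<dots> = (\<Sum>g\<in>carrier F.
        (\<lambda>h. (\<Sum>k<d. S p $$ (i, k) * U h $$ (k, 0)) * T h $$ (0, j)) (g \<otimes>\<^bsub>F\<^esub> p))"
      by (intro sum.cong refl) (use eq in auto)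
    also have "\<dots> = (\<Sum>h\<in>carrier F. (\<Sum>k<d. S p $$ (i, k) * U h $$ (k, 0)) * T h $$ (0, j))"
      by (rule sum.reindex_bij_witness[of _ "\<lambda>h. h \<otimes>\<^bsub>F\<^esub> inv\<^bsub>F\<^esub> p" "\<lambda>g. g \<otimes>\<^bsub>F\<^esub> p"])
        (use p in \<open>auto simp: F.m_assoc\<close>)
    also have "\<dots> = (\<Sum>k<d. S p $$ (i, k) * (\<Sum>h\<in>carrier F. U h $$ (k, 0) * T h $$ (0, j)))"
      unfolding sum_distrib_left sum_distrib_right by (subst sum.swap) (simp add: mult_ac)
    also have "\<dots> = (S p * \<Phi>) $$ (i, j)"
      using Sc[OF p] ij \<Phi> by (simp add: scalar_prod_def atLeast0LessThan \<Phi>_def)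
    finally show "(\<Phi> * T p) $$ (i, j) = (S p * \<Phi>) $$ (i, j)" .
  qed (use Sc[OF p] Tc[OF p] \<Phi> in auto)
  show "\<Phi> = 0\<^sub>m d d \<or> det \<Phi> \<noteq> 0"
    by (rule schur_zero_or_invertible[OF irr Tc \<Phi>]) (use comm Sc in blast)+
qed

text \<open>A finite group \<open>F\<close> has at most \<open>|F|\<close> inequivalent irreducible projective representations with a
  given multiplier. For inequivalent ones the averages \<open>\<Phi> l m\<close> are nonzero exactly for \<open>l = m\<close>; hence
  the coefficient functions at \<open>(0, 0)\<close> are linearly independent functions on \<open>F\<close>.\<close>

lemma card_inequivalent_projective_reps:
  fixes T :: "nat \<Rightarrow> 'g \<Rightarrow> complex mat"
  assumes F: "group F" "finite (carrier F)"
    and T: "\<And>m. m \<le> card (carrier F) \<Longrightarrow> projective_rep F d \<alpha> (T m)"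
    and irr: "\<And>m. m \<le> card (carrier F) \<Longrightarrow> irreducible_rep F d (T m)"
  shows "\<exists>l m P. l < m \<and> m \<le> card (carrier F) \<and> P \<in> carrier_mat d d \<and> det P \<noteq> 0 \<and>
           (\<forall>p\<in>carrier F. P * T m p = T l p * P)"
proof (rule ccontr)
  assume no: "\<not> ?thesis"
  interpret F: group F by (rule F)
  define N where "N = card (carrier F)"
  have N: "N > 0" using F unfolding N_def by (simp add: card_gt_0_iff F.carrier_not_empty)
  have d: "d > 0" using irr[of 0] by (simp add: irreducible_rep_def)
  have Tc: "T m p \<in> carrier_mat d d" "det (T m p) \<noteq> 0" if "p \<in> carrier F" "m \<le> N" for m p
    using T that by (auto simp: projective_rep_def N_def)
  have "\<exists>U. U \<in> carrier_mat d d \<and> T m p * U = 1\<^sub>m d \<and> U * T m p = 1\<^sub>m d"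
    if "p \<in> carrier F" "m \<le> N" for m p
    using Tc[OF that] by (metis obtain_inverse_mat)
  note inv_ex = this
  define U where "U m p = (SOME U. U \<in> carrier_mat d d \<and> T m p * U = 1\<^sub>m d \<and> U * T m p = 1\<^sub>m d)" for m p
  have U: "U m p \<in> carrier_mat d d \<and> T m p * U m p = 1\<^sub>m d \<and> U m p * T m p = 1\<^sub>m d"
    if "p \<in> carrier F" "m \<le> N" for m p
    unfolding U_def by (rule someI_ex) (rule inv_ex[OF that])
  define \<Phi> where "\<Phi> l m = mat d d (\<lambda>(i, j). \<Sum>g\<in>carrier F. U l g $$ (i, 0) * T m g $$ (0, j))" for l m
  have avg: "\<Phi> l m \<in> carrier_mat d d" "\<And>p. p \<in> carrier F \<Longrightarrow> \<Phi> l m * T m p = T l p * \<Phi> l m"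
      "\<Phi> l m = 0\<^sub>m d d \<or> det (\<Phi> l m) \<noteq> 0" if "l \<le> N" "m \<le> N" for l m
    using projective_schur_averages[OF F T T irr, of m l "U l"] U that unfolding \<Phi>_def N_def by auto
  have off: "\<Phi> l m = 0\<^sub>m d d" if "l \<le> N" "m \<le> N" "l \<noteq> m" for l m
  proof (rule ccontr)
    assume "\<Phi> l m \<noteq> 0\<^sub>m d d"
    then have det: "det (\<Phi> l m) \<noteq> 0" using avg(3) that by blast
    show False
    proof (cases "l < m")
      case True
      then show False using no det avg(1,2) that unfolding N_def by blast
    next
      case False
      obtain Q where Q: "Q \<in> carrier_mat d d" "\<Phi> l m * Q = 1\<^sub>m d" "Q * \<Phi> l m = 1\<^sub>m d"
        using obtain_inverse_mat[OF avg(1)[OF \<open>l \<le> N\<close> \<open>m \<le> N\<close>] det] by blast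
      have "det Q * det (\<Phi> l m) = 1"
        using det_mult[OF Q(1) avg(1)[OF \<open>l \<le> N\<close> \<open>m \<le> N\<close>]] Q(3) by simp
      then have "det Q \<noteq> 0" by auto
      moreover have "Q * T l p = T m p * Q" if p: "p \<in> carrier F" for p
      proof -
        have P: "\<Phi> l m \<in> carrier_mat d d" and Tl: "T l p \<in> carrier_mat d d" and Tm: "T m p \<in> carrier_mat d d"
          using avg(1) Tc p \<open>l \<le> N\<close> \<open>m \<le> N\<close> by auto
        have "Q * T l p = Q * (T l p * (\<Phi> l m * Q))" using Q Tl by simp
        also have "\<dots> = Q * (T l p * \<Phi> l m) * Q"
          using Q(1) P Tl by (simp add: assoc_mult_mat[of _ d d _ d _ d])
        also have "T l p * \<Phi> l m = \<Phi> l m * T m p" using avg(2)[of l m p] p \<open>l \<le> N\<close> \<open>m \<le> N\<close> by simp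
        also have "Q * (\<Phi> l m * T m p) * Q = (Q * \<Phi> l m) * T m p * Q"
          using Q(1) P Tm by (simp add: assoc_mult_mat[of _ d d _ d _ d])
        also have "\<dots> = T m p * Q" using Q(3) Tm by simp
        finally show ?thesis .
      qed
      ultimately show False using no Q(1) False that unfolding N_def
        by (metis linorder_neqE_nat)
    qed
  qed
  have diag: "\<Phi> m m $$ (0, 0) \<noteq> 0" if m: "m \<le> N" for m
  proof -
    have "\<exists>k. \<Phi> m m = k \<cdot>\<^sub>m 1\<^sub>m d"
      by (rule schur_scalar[OF irr]) (use m avg(1,2) Tc in \<open>auto simp: N_def\<close>)
    then obtain k where k: "\<Phi> m m = k \<cdot>\<^sub>m 1\<^sub>m d" by auto
    have "of_nat d * k = (\<Sum>i<d. \<Phi> m m $$ (i, i))" by (simp add: k)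
    also have "\<dots> = (\<Sum>g\<in>carrier F. \<Sum>i<d. T m g $$ (0, i) * U m g $$ (i, 0))"
      unfolding \<Phi>_def by (simp add: mult.commute) (rule sum.swap)
    also have "\<dots> = (\<Sum>g\<in>carrier F. 1)"
    proof (rule sum.cong)
      fix g assume g: "g \<in> carrier F"
      have "(\<Sum>i<d. T m g $$ (0, i) * U m g $$ (i, 0)) = (T m g * U m g) $$ (0, 0)"
        using conjunct1[OF U[OF g m]] Tc[OF g m] d by (simp add: scalar_prod_def atLeast0LessThan)
      then show "(\<Sum>i<d. T m g $$ (0, i) * U m g $$ (i, 0)) = 1" using U[OF g m] d by simp
    qed simp
    finally have "of_nat d * k = of_nat N" by (simp add: N_def)
    then have "k \<noteq> 0" using N by auto
    then show ?thesis using d by (simp add: k)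
  qed
  obtain e where e: "bij_betw e {..<N} (carrier F)"
    using ex_bij_betw_nat_finite[OF F(2)] by (auto simp: N_def atLeast0LessThan)
  obtain c where c: "\<exists>t\<le>N. c t \<noteq> 0" "\<And>i. i < N \<Longrightarrow> (\<Sum>t\<le>N. c t * T t (e i) $$ (0, 0)) = 0"
    using linear_dependency[of N "\<lambda>t i. T t (e i) $$ (0, 0)"] by auto
  have c': "(\<Sum>t\<le>N. c t * T t g $$ (0, 0)) = 0" if g: "g \<in> carrier F" for g
  proof -
    have "g \<in> e ` {..<N}" using e g by (simp add: bij_betw_def)
    then obtain i where "i < N" "e i = g" by auto
    then show ?thesis using c(2)[of i] by simp
  qed
  obtain l where l: "l \<le> N" "c l \<noteq> 0" using c(1) by auto
  have "0 = (\<Sum>g\<in>carrier F. U l g $$ (0, 0) * (\<Sum>t\<le>N. c t * T t g $$ (0, 0)))"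
    by (simp add: c')
  also have "\<dots> = (\<Sum>t\<le>N. c t * (\<Sum>g\<in>carrier F. U l g $$ (0, 0) * T t g $$ (0, 0)))"
    unfolding sum_distrib_left by (subst sum.swap) (simp add: mult_ac)
  also have "\<dots> = (\<Sum>t\<le>N. c t * \<Phi> l t $$ (0, 0))" using d by (simp add: \<Phi>_def)
  also have "\<dots> = (\<Sum>t\<le>N. if t = l then c l * \<Phi> l l $$ (0, 0) else 0)"
    by (intro sum.cong refl) (use off l d in auto)
  also have "\<dots> = c l * \<Phi> l l $$ (0, 0)" using l by simp
  finally show False using l diag by auto
qed

section \<open>Complex matrix groups have no small subgroups\<close>

text \<open>If \<open>h = 1 + X\<close>, then
  \<open>2 X = (h\<^sup>2 - 1) - X\<^sup>2\<close>; so a bound \<open>s \<le> 1 / (2 d)\<close> on the entries of \<open>h - 1\<close> and \<open>h\<^sup>2 - 1\<close> improves to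
  \<open>3 s / 4\<close>.\<close>

lemma no_small_square_closed_sets:
  fixes H :: "complex mat set"
  assumes d: "d > 0" and car: "H \<subseteq> carrier_mat d d"
    and sq: "\<And>h. h \<in> H \<Longrightarrow> h * h \<in> H"
    and small: "\<And>h i j. h \<in> H \<Longrightarrow> i < d \<Longrightarrow> j < d \<Longrightarrow>
      cmod (h $$ (i, j) - 1\<^sub>m d $$ (i, j)) \<le> 1 / (2 * real d)"
    and h: "h \<in> H"
  shows "h = 1\<^sub>m d"
proof -
  define \<epsilon> where "\<epsilon> = 1 / (2 * real d)"
  have bound: "cmod (h $$ (i, j) - 1\<^sub>m d $$ (i, j)) \<le> (3/4) ^ n * \<epsilon>"
    if "h \<in> H" "i < d" "j < d" for h i j n
    using that
  proof (induction n arbitrary: h i j)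
    case 0 then show ?case using small by (simp add: \<epsilon>_def)
  next
    case (Suc n)
    define s where "s = (3/4) ^ n * \<epsilon>"
    have s: "0 \<le> s" "s \<le> \<epsilon>" using d by (auto simp: s_def \<epsilon>_def power_le_one mult_left_le_one_le divide_right_mono)
    define X where "X i j = h $$ (i, j) - 1\<^sub>m d $$ (i, j)" for i j
    have hc: "h \<in> carrier_mat d d" using Suc.prems(1) car by auto
    have X: "cmod (X i j) \<le> s" if "i < d" "j < d" for i j
      using Suc.IH[OF Suc.prems(1) that] by (simp add: X_def s_def)
    have "(h * h) $$ (i, j) = (\<Sum>k<d. h $$ (i, k) * h $$ (k, j))"
      using hc Suc.prems by (simp add: scalar_prod_def atLeast0LessThan)
    also have "\<dots> = (\<Sum>k<d. X i k * X k j + X i k * 1\<^sub>m d $$ (k, j) + 1\<^sub>m d $$ (i, k) * X k j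
        + 1\<^sub>m d $$ (i, k) * 1\<^sub>m d $$ (k, j))"
      by (intro sum.cong refl) (simp add: X_def algebra_simps)
    also have "\<dots> = (\<Sum>k<d. X i k * X k j) + (\<Sum>k<d. X i k * 1\<^sub>m d $$ (k, j))
        + (\<Sum>k<d. 1\<^sub>m d $$ (i, k) * X k j) + (\<Sum>k<d. 1\<^sub>m d $$ (i, k) * 1\<^sub>m d $$ (k, j))"
      by (simp add: sum.distrib)
    also have "(\<Sum>k<d. X i k * 1\<^sub>m d $$ (k, j)) = (\<Sum>k<d. if k = j then X i j else 0)"
      using Suc.prems by (intro sum.cong) auto
    also have "(\<Sum>k<d. 1\<^sub>m d $$ (i, k) * X k j) = (\<Sum>k<d. if k = i then X i j else 0)"
      using Suc.prems by (intro sum.cong) auto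
    also have "(\<Sum>k<d. 1\<^sub>m d $$ (i, k) * (1\<^sub>m d $$ (k, j) :: complex)) = (\<Sum>k<d. if k = i then 1\<^sub>m d $$ (i, j) else 0)"
      using Suc.prems by (intro sum.cong) auto
    finally have eq: "2 * X i j = ((h * h) $$ (i, j) - 1\<^sub>m d $$ (i, j)) - (\<Sum>k<d. X i k * X k j)"
      using Suc.prems by simp
    have "cmod (\<Sum>k<d. X i k * X k j) \<le> (\<Sum>k<d. s * s)"
      by (intro order.trans[OF norm_sum] sum_mono) (use X Suc.prems s in \<open>auto simp: norm_mult intro!: mult_mono\<close>)
    also have "\<dots> = real d * s * s" by simp
    also have "\<dots> \<le> real d * \<epsilon> * s" using s by (intro mult_right_mono mult_left_mono) auto
    also have "\<dots> = s / 2" using d by (simp add: \<epsilon>_def)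
    finally have "cmod (\<Sum>k<d. X i k * X k j) \<le> s / 2" .
    moreover have "cmod ((h * h) $$ (i, j) - 1\<^sub>m d $$ (i, j)) \<le> s"
      using Suc.IH[OF sq[OF Suc.prems(1)] Suc.prems(2,3)] by (simp add: s_def)
    ultimately have "cmod (2 * X i j) \<le> s + s / 2"
      unfolding eq by (intro order.trans[OF norm_triangle_ineq4]) simp
    then have "cmod (X i j) \<le> 3 / 4 * s" by (simp add: norm_mult)
    then show ?case by (simp add: X_def s_def)
  qed
  show ?thesis
  proof (rule eq_matI)
    fix i j assume "i < dim_row (1\<^sub>m d :: complex mat)" "j < dim_col (1\<^sub>m d :: complex mat)"
    then have ij: "i < d" "j < d" by auto
    have "(\<lambda>n. (3/4 :: real) ^ n * \<epsilon>) \<longlonglongrightarrow> 0 * \<epsilon>"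
      by (intro tendsto_intros LIMSEQ_power_zero) simp
    then have "cmod (h $$ (i, j) - 1\<^sub>m d $$ (i, j)) \<le> 0"
      using bound[OF h ij] by (intro LIMSEQ_le_const) auto
    then show "h $$ (i, j) = 1\<^sub>m d $$ (i, j)" by simp
  qed (use h car in auto)
qed

section \<open>Arithmetic of discrete valuation rings\<close>

text \<open>A uniformizer \<open>\<pi>\<close> of a discrete valuation ring with finite residue field. Completeness enters
  only through the separatedness of the \<open>\<pi>\<close>-adic topology.\<close>

locale local_uniformizer =
  fixes \<pi> :: "'a :: idom"
  assumes uniformizer_nonzero: "\<pi> \<noteq> 0"
    and uniformizer_not_unit: "\<not> \<pi> dvd 1"
    and unit_or_dvd: "x dvd 1 \<or> \<pi> dvd x"
    and separated: "(\<And>k. \<pi> ^ k dvd x) \<Longrightarrow> x = 0"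
    and finite_residues: "\<exists>R. finite R \<and> (\<forall>x. \<exists>r\<in>R. \<pi> dvd x - r)"
begin

lemma unit_iff: "x dvd 1 \<longleftrightarrow> \<not> \<pi> dvd x"
  using unit_or_dvd uniformizer_not_unit dvd_trans by blast

lemma nonunit_add_unit: "\<not> (x :: 'a) dvd 1 \<Longrightarrow> y dvd 1 \<Longrightarrow> x + y dvd 1"
  unfolding unit_iff by (metis dvd_add_right_iff)

lemma dvd_uniformizer_power:
  assumes "e \<noteq> 0" shows "\<exists>s. e dvd \<pi> ^ s"
proof -
  obtain k where k: "\<not> \<pi> ^ k dvd e" using separated assms by blast
  define s where "s = (LEAST k. \<not> \<pi> ^ k dvd e)"
  have s: "\<not> \<pi> ^ s dvd e" unfolding s_def by (rule LeastI[of _ k]) (rule k)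
  then obtain t where t: "s = Suc t" by (cases s) auto
  have "\<pi> ^ t dvd e" using not_less_Least[of t "\<lambda>k. \<not> \<pi> ^ k dvd e"] t unfolding s_def by auto
  then obtain x where x: "e = \<pi> ^ t * x" by (auto simp: dvd_def)
  have "\<not> \<pi> dvd x" using s by (auto simp: t x mult.commute intro: mult_dvd_mono)
  then have "x dvd 1" by (simp add: unit_iff)
  then have "\<pi> ^ t * x dvd \<pi> ^ t * 1" by (intro mult_dvd_mono) auto
  then have "e dvd \<pi> ^ t" unfolding x by simp
  then show ?thesis ..
qed

lemma finite_residues_power: "\<exists>R. finite R \<and> (\<forall>x. \<exists>r\<in>R. \<pi> ^ k dvd x - r)"
proof (induction k)
  case 0 show ?case by (rule exI[of _ "{0}"]) auto
next
  case (Suc k)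
  obtain R where R: "finite R" "\<And>x. \<exists>r\<in>R. \<pi> ^ k dvd x - r" using Suc by auto
  obtain Q where Q: "finite Q" "\<And>x. \<exists>r\<in>Q. \<pi> dvd x - r" using finite_residues by auto
  have "\<exists>r\<in>(\<lambda>(q, r). q + \<pi> * r) ` (Q \<times> R). \<pi> ^ Suc k dvd x - r" for x
  proof -
    obtain q y where q: "q \<in> Q" "x - q = \<pi> * y" using Q(2)[of x] by (auto simp: dvd_def)
    obtain r z where r: "r \<in> R" "y - r = \<pi> ^ k * z" using R(2)[of y] by (auto simp: dvd_def)
    have "x - (q + \<pi> * r) = \<pi> * (y - r)" using q(2) by (simp add: algebra_simps)
    then have "x - (q + \<pi> * r) = \<pi> ^ Suc k * z" by (simp add: r mult_ac)
    then show ?thesis using q r by (intro bexI[of _ "q + \<pi> * r"]) auto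
  qed
  then show ?case using R Q by (intro exI[of _ "(\<lambda>(q, r). q + \<pi> * r) ` (Q \<times> R)"]) auto
qed

lemma finite_residues_nonzero:
  assumes "e \<noteq> (0 :: 'a)" shows "\<exists>R. finite R \<and> (\<forall>x. \<exists>r\<in>R. e dvd x - r)"
proof -
  obtain s where "e dvd \<pi> ^ s" using dvd_uniformizer_power[OF assms] by blast
  then show ?thesis using finite_residues_power[of s] by (meson dvd_trans)
qed

text \<open>The units \<open>1 + \<pi>\<^sup>i\<close> are pairwise distinct, and only finitely many elements of a domain are roots of
  \<open>x\<^sup>N - 1\<close>.\<close>

lemma unit_of_large_order:
  assumes N: "N > 0"
  shows "\<exists>u v :: 'a. u * v = 1 \<and> u ^ N \<noteq> 1"
proof (rule ccontr)
  assume no: "\<not> ?thesis"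
  have "(1 + \<pi> ^ Suc i) ^ N = 1" for i
  proof -
    have "1 + \<pi> ^ Suc i dvd 1"
      unfolding unit_iff using uniformizer_not_unit dvd_add_left_iff[of \<pi> "\<pi> ^ Suc i" 1] by auto
    then obtain v where "(1 + \<pi> ^ Suc i) * v = 1" by (auto elim: dvdE)
    then show ?thesis using no by blast
  qed
  then have "range (\<lambda>i. 1 + \<pi> ^ Suc i) \<subseteq> {x. poly (Polynomial.monom 1 N - 1) x = 0}"
    by (auto simp: poly_monom)
  moreover have "finite {x. poly (Polynomial.monom 1 N - 1 :: 'a poly) x = 0}"
  proof (rule poly_roots_finite)
    have "Polynomial.coeff (Polynomial.monom 1 N - 1 :: 'a poly) N = 1" using N by simp
    then show "Polynomial.monom 1 N - 1 \<noteq> (0 :: 'a poly)" by (metis coeff_0 zero_neq_one)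
  qed
  ultimately have "finite (range (\<lambda>i. 1 + \<pi> ^ Suc i))" by (rule finite_subset)
  then have "\<not> inj (\<lambda>i. 1 + \<pi> ^ Suc i)" using finite_imageD infinite_UNIV_nat by blast
  then obtain i j where ij: "i \<noteq> j" "\<pi> ^ Suc i = \<pi> ^ Suc j" by (auto simp: inj_def)
  have *: False if "i < j" "\<pi> ^ Suc i = \<pi> ^ Suc j" for i j
  proof -
    have "\<pi> ^ Suc j = \<pi> ^ Suc i * \<pi> ^ (j - i)" using that(1) by (simp flip: power_add)
    then have "\<pi> ^ (j - i) = 1" using that(2) uniformizer_nonzero by simp
    moreover have "\<pi> dvd \<pi> ^ (j - i)" using that(1) by (simp add: dvd_power)
    ultimately show False using uniformizer_not_unit by simp
  qed
  show False using *[of i j] *[of j i] ij by (metis linorder_neqE_nat)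
qed

end

lemma cgenideal_class_ring:
  "cgenideal (class_ring :: 'a :: comm_ring_1 ring) a = {x. a dvd x}"
  by (auto simp: cgenideal_def dvd_def mult.commute)

lemma ideal_prod_principal:
  "ideal_prod (class_ring :: 'a :: comm_ring_1 ring) {x. a dvd x} {x. b dvd x} = {x. a * b dvd x}"
proof (intro equalityI subsetI)
  fix x assume "x \<in> ideal_prod (class_ring :: 'a ring) {x. a dvd x} {x. b dvd x}"
  then show "x \<in> {x. a * b dvd x}"
    by (induction rule: ideal_prod.induct) (auto simp: mult_dvd_mono)
next
  fix x :: 'a assume "x \<in> {x. a * b dvd x}"
  then obtain c where "x = a * (b * c)" by (auto simp: dvd_def mult.assoc)
  then show "x \<in> ideal_prod (class_ring :: 'a ring) {x. a dvd x} {x. b dvd x}"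
    using ideal_prod.prod[of a "{x. a dvd x}" "b * c" "{x. b dvd x}" "class_ring :: 'a ring"] by simp
qed

lemma ideal_power_principal:
  "ideal_power (class_ring :: 'a :: comm_ring_1 ring) {x. a dvd x} k = {x. a ^ k dvd x}"
proof (induction k)
  case 0 show ?case by (simp add: ideal_power_def ideals_set_def)
next
  case (Suc k)
  have "ideal_power (class_ring :: 'a ring) {x. a dvd x} (Suc k) =
      ideal_prod class_ring (ideal_power class_ring {x. a dvd x} k) {x. a dvd x}"
    by (simp add: ideal_power_def ideals_set_def)
  then show ?case using Suc by (simp add: ideal_prod_principal mult.commute)
qed

text \<open>A generator of the maximal ideal satisfies the axioms of \<open>local_uniformizer\<close>, and its powers generate
  the powers of the maximal ideal.\<close>

lemma complete_dvr_uniformizer: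
  assumes dvr: "complete_discrete_valuation_ring (class_ring :: 'a :: idom ring)"
    and fin: "finite (carrier ((class_ring :: 'a :: idom ring) Quot max_ideal class_ring))"
  obtains \<pi> :: "'a :: idom" where "local_uniformizer \<pi>"
    and "\<And>k. ideal_power class_ring (max_ideal class_ring) k = {x. \<pi> ^ k dvd x}"
proof -
  let ?R = "class_ring :: 'a ring"
  interpret R: complete_discrete_valuation_ring ?R by (rule dvr)
  obtain M where M: "maximalideal M ?R" using ex1_implies_ex[OF R.local] by (elim exE)
  have uniq: "M' = M" if "maximalideal M' ?R" for M'
    using the1_equality[OF R.local that] the1_equality[OF R.local M] by (rule trans[OF sym])
  have maxM: "max_ideal ?R = M" unfolding max_ideal_def by (rule the1_equality[OF R.local M])
  interpret M: maximalideal M ?R by (rule M)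
  obtain \<pi> where \<pi>: "M = {x. \<pi> dvd x}"
    using R.exists_gen[OF M.is_ideal] by (auto simp: cgenideal_class_ring)
  have not_unit: "\<not> \<pi> dvd 1"
  proof
    assume "\<pi> dvd 1"
    then have "M = UNIV" unfolding \<pi> using dvd_trans one_dvd by blast
    then show False using M.I_notcarr by simp
  qed
  have nonzero: "\<pi> \<noteq> 0"
  proof
    assume "\<pi> = 0"
    then have "M = {\<zero>\<^bsub>?R\<^esub>}" by (simp add: \<pi>)
    moreover have "cring ?R" by unfold_locales
    ultimately have "field ?R" using M cring.zeromaximalideal_fieldI by blast
    then show False using R.not_field by simp
  qed
  have unit_or: "x dvd 1 \<or> \<pi> dvd x" for x
  proof (cases "x dvd 1")
    case False
    show ?thesis
    proof (cases "x = 0")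
      case False
      have "x \<notin> Units ?R"
        using \<open>\<not> x dvd 1\<close> by (auto simp: Units_def dvd_def)
      moreover have "x \<in> carrier ?R - {\<zero>\<^bsub>?R\<^esub>}" using False by simp
      ultimately obtain p where p: "p \<in> carrier ?R" "ring_irreducible\<^bsub>?R\<^esub> p" "p divides\<^bsub>?R\<^esub> x"
        using R.exists_irreducible_divisor by metis
      have "{y. p dvd y} = M"
        using uniq R.irreducible_imp_maximalideal[OF p(1,2)] by (simp add: cgenideal_class_ring)
      moreover have "p dvd x" using p(3) by (auto simp: factor_def dvd_def)
      ultimately show ?thesis using \<pi> by auto
    qed simp
  qed simp
  have "local_uniformizer \<pi>"
  proof
    fix x assume x: "\<And>k. \<pi> ^ k dvd x"
    have "(\<Inter>k. ideal_power ?R M k) = {\<zero>\<^bsub>?R\<^esub>}"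
      using R.complete unfolding adically_complete_def maxM by simp
    then have "(\<Inter>k. {x. \<pi> ^ k dvd x}) = {0}" unfolding \<pi> ideal_power_principal by simp
    moreover have "x \<in> (\<Inter>k. {x. \<pi> ^ k dvd x})" using x by auto
    ultimately show "x = 0" by simp
  next
    have fin': "finite (a_rcosets\<^bsub>?R\<^esub> M)" using fin by (simp add: FactRing_def maxM)
    define R where "R = (\<lambda>C. SOME r. r \<in> C) ` (a_rcosets\<^bsub>?R\<^esub> M)"
    have "\<exists>r\<in>R. \<pi> dvd x - r" for x
    proof -
      let ?C = "M +>\<^bsub>?R\<^esub> x"
      have C: "?C = {m + x |m. m \<in> M}" by (auto simp: a_r_coset_def r_coset_def)
      have "?C \<in> a_rcosets\<^bsub>?R\<^esub> M" by (auto simp: A_RCOSETS_def RCOSETS_def a_r_coset_def)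
      then have "(SOME r. r \<in> ?C) \<in> R" unfolding R_def by (rule imageI)
      moreover have "(SOME r. r \<in> ?C) \<in> ?C"
        by (rule someI[of _ "0 + x"]) (use M.zero_closed in \<open>auto simp: C\<close>)
      then obtain m where m: "m \<in> M" "(SOME r. r \<in> ?C) = m + x" unfolding C by blast
      then have "\<pi> dvd x - (SOME r. r \<in> ?C)" by (simp add: \<pi>)
      ultimately show ?thesis by blast
    qed
    then show "\<exists>R. finite R \<and> (\<forall>x. \<exists>r\<in>R. \<pi> dvd x - r)"
      using fin' unfolding R_def by blast
  qed (use not_unit nonzero unit_or in auto)
  then show thesis using that by (simp add: maxM \<pi> ideal_power_principal)
qed

section \<open>General linear groups and congruence subgroups\<close>

lemma GL_iff:
  "g \<in> carrier (GL n) \<longleftrightarrow>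
     g \<in> carrier_mat n n \<and> (\<exists>h\<in>carrier_mat n n. g * h = 1\<^sub>m n \<and> h * g = 1\<^sub>m n)"
  by (auto simp: GL_def units_of_def Units_def ring_mat_def)

lemma GL_simps [simp]: "x \<otimes>\<^bsub>GL n\<^esub> y = x * y" "\<one>\<^bsub>GL n\<^esub> = 1\<^sub>m n"
  by (simp_all add: GL_def units_of_def ring_mat_def)

lemma GL_group: "group (GL n :: 'a :: comm_ring_1 mat monoid)"
proof -
  interpret R: semiring "ring_mat TYPE('a) n ()" by (rule semiring_mat)
  show ?thesis unfolding GL_def by (rule R.units_group)
qed

lemma GL_carrier: "g \<in> carrier (GL n) \<Longrightarrow> g \<in> carrier_mat n n"
  by (simp add: GL_iff)

lemma GL_field_iff: "g \<in> carrier (GL n) \<longleftrightarrow> g \<in> carrier_mat n n \<and> det (g :: 'a :: field mat) \<noteq> 0"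
proof
  assume "g \<in> carrier (GL n)"
  then have "g \<in> Units (ring_mat TYPE('a) n ())" by (simp add: GL_def units_of_def)
  then show "g \<in> carrier_mat n n \<and> det g \<noteq> 0"
    using unit_imp_det_non_zero by (auto simp: Units_def ring_mat_def)
next
  assume "g \<in> carrier_mat n n \<and> det g \<noteq> 0"
  then show "g \<in> carrier (GL n)" using obtain_inverse_mat[of g n] by (auto simp: GL_iff)
qed

lemma GL_inv:
  assumes "g \<in> carrier (GL n)"
  shows "inv\<^bsub>GL n\<^esub> g \<in> carrier_mat n n" "g * inv\<^bsub>GL n\<^esub> g = 1\<^sub>m n" "inv\<^bsub>GL n\<^esub> g * g = 1\<^sub>m n"
proof -
  interpret group "GL n" by (rule GL_group)
  show "inv\<^bsub>GL n\<^esub> g \<in> carrier_mat n n" using inv_closed[OF assms] by (rule GL_carrier)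
  show "g * inv\<^bsub>GL n\<^esub> g = 1\<^sub>m n" "inv\<^bsub>GL n\<^esub> g * g = 1\<^sub>m n"
    using r_inv[OF assms] l_inv[OF assms] by auto
qed

lemma addrow_mat_GL:
  "k < n \<Longrightarrow> l < n \<Longrightarrow> k \<noteq> l \<Longrightarrow> addrow_mat n (a :: 'a :: comm_ring_1) k l \<in> carrier (GL n)"
  unfolding GL_def units_of_carrier by (rule addrow_mat_Unit)

lemma addrow_mat_add:
  assumes "k < n" "l < n" "k \<noteq> l"
  shows "addrow_mat n (a :: 'a :: comm_ring_1) k l * addrow_mat n b k l = addrow_mat n (a + b) k l"
  by (subst addrow_mat[symmetric, of _ n n]) (use assms in \<open>auto intro!: eq_matI\<close>)

lemma addrow_mat_zero: "k \<noteq> l \<Longrightarrow> addrow_mat n 0 k l = (1\<^sub>m n :: 'a :: comm_ring_1 mat)"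
  by (intro eq_matI) auto

lemma mat_diag_mult:
  "mat_diag n f * mat_diag n g = mat_diag n (\<lambda>i. f i * g i :: 'a :: comm_ring_1)"
  by (subst mat_diag_mult_left[of _ _ n]) (auto simp: mat_diag_def intro!: eq_matI)

lemma mat_diag_GL:
  assumes "\<And>i. i < n \<Longrightarrow> f i dvd (1 :: 'a :: comm_ring_1)"
  shows "mat_diag n f \<in> carrier (GL n)"
proof -
  have "\<exists>f'. \<forall>i<n. 1 = f i * f' i" using assms by (intro choice) (auto simp: dvd_def)
  then obtain f' where f': "\<And>i. i < n \<Longrightarrow> f i * f' i = 1" by metis
  have "mat_diag n f * mat_diag n f' = 1\<^sub>m n" "mat_diag n f' * mat_diag n f = 1\<^sub>m n"
    unfolding mat_diag_mult using f' by (auto simp: mat_diag_def mult.commute intro!: eq_matI)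
  then show ?thesis unfolding GL_iff by (auto intro!: bexI[of _ "mat_diag n f'"])
qed

lemma mat_diag_addrow_mat:
  assumes "k < n" "l < n" "k \<noteq> l" and "f k * a = b * f l"
  shows "mat_diag n f * addrow_mat n a k l = addrow_mat n b k l * mat_diag n (f :: nat \<Rightarrow> 'a :: comm_ring_1)"
  by (subst mat_diag_mult_left[of _ n n], simp, subst mat_diag_mult_right[of _ n n], simp)
    (use assms in \<open>auto intro!: eq_matI\<close>)

text \<open>The principal congruence subgroup: the invertible matrices congruent to \<open>1\<close> modulo \<open>e\<close>.\<close>

definition level_subgroup :: "nat \<Rightarrow> 'a :: comm_ring_1 \<Rightarrow> 'a mat set" where
  "level_subgroup n e = {g \<in> carrier (GL n). \<exists>X\<in>carrier_mat n n. g = 1\<^sub>m n + e \<cdot>\<^sub>m X}"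

lemma mat_dvd_iff:
  fixes e :: "'a :: comm_ring_1"
  assumes "A \<in> carrier_mat n m" "B \<in> carrier_mat n m"
  shows "(\<exists>X\<in>carrier_mat n m. A = B + e \<cdot>\<^sub>m X) \<longleftrightarrow> (\<forall>i<n. \<forall>j<m. e dvd A $$ (i, j) - B $$ (i, j))"
proof
  assume R: "\<forall>i<n. \<forall>j<m. e dvd A $$ (i, j) - B $$ (i, j)"
  define X where "X = mat n m (\<lambda>(i, j). SOME x. A $$ (i, j) - B $$ (i, j) = e * x)"
  have "A $$ (i, j) - B $$ (i, j) = e * X $$ (i, j)" if "i < n" "j < m" for i j
    using R that someI_ex[of "\<lambda>x. A $$ (i, j) - B $$ (i, j) = e * x"] by (auto simp: X_def dvd_def)
  then have "A = B + e \<cdot>\<^sub>m X" using assms by (intro eq_matI) (auto simp: X_def algebra_simps)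
  then show "\<exists>X\<in>carrier_mat n m. A = B + e \<cdot>\<^sub>m X" by (auto simp: X_def)
qed (use assms in auto)

lemma level_subgroup_iff:
  "g \<in> level_subgroup n e \<longleftrightarrow> g \<in> carrier (GL n) \<and> (\<forall>i<n. \<forall>j<n. e dvd g $$ (i, j) - 1\<^sub>m n $$ (i, j))"
  using mat_dvd_iff[of g n n "1\<^sub>m n" e] GL_carrier[of g n] by (auto simp: level_subgroup_def)

lemma level_subgroup_GL: "g \<in> level_subgroup n e \<Longrightarrow> g \<in> carrier (GL n)"
  by (simp add: level_subgroup_def)

lemma level_subgroup_normal: "level_subgroup n (e :: 'a :: comm_ring_1) \<lhd> GL n"
proof -
  interpret G: group "GL n :: 'a mat monoid" by (rule GL_group)
  let ?N = "level_subgroup n e"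
  have sub: "subgroup ?N (GL n)"
  proof (rule G.subgroupI)
    show "?N \<subseteq> carrier (GL n)" by (auto simp: level_subgroup_def)
    have "1\<^sub>m n \<in> ?N" using G.one_closed by (simp add: level_subgroup_iff)
    then show "?N \<noteq> {}" by auto
  next
    fix g assume g: "g \<in> ?N"
    let ?h = "inv\<^bsub>GL n\<^esub> g"
    note gc = level_subgroup_GL[OF g]
    obtain X where X: "X \<in> carrier_mat n n" "g = 1\<^sub>m n + e \<cdot>\<^sub>m X" using g by (auto simp: level_subgroup_def)
    note h = GL_inv[OF gc]
    have "1\<^sub>m n = (1\<^sub>m n + e \<cdot>\<^sub>m X) * ?h" using h X by simp
    also have "\<dots> = ?h + e \<cdot>\<^sub>m (X * ?h)"
      using h(1) X(1) by (simp add: add_mult_distrib_mat[of _ n n _ _ n] mult_smult_assoc_mat[of _ n n _ n])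
    finally have eq: "1\<^sub>m n = ?h + e \<cdot>\<^sub>m (X * ?h)" .
    have "?h = 1\<^sub>m n + e \<cdot>\<^sub>m (- (X * ?h))"
    proof (rule eq_matI)
      fix i j assume "i < dim_row (1\<^sub>m n + e \<cdot>\<^sub>m (- (X * ?h)))" "j < dim_col (1\<^sub>m n + e \<cdot>\<^sub>m (- (X * ?h)))"
      then have ij: "i < n" "j < n" using X(1) h(1) by auto
      have XH: "X * ?h \<in> carrier_mat n n" using X(1) h(1) by auto
      have "1\<^sub>m n $$ (i, j) = ?h $$ (i, j) + e * (X * ?h) $$ (i, j)"
        using arg_cong[OF eq, of "\<lambda>A. A $$ (i, j)"] ij h(1) XH by (simp del: index_mult_mat)
      then show "?h $$ (i, j) = (1\<^sub>m n + e \<cdot>\<^sub>m (- (X * ?h))) $$ (i, j)"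
        using ij XH h(1) by (simp del: index_mult_mat)
    qed (use X(1) h(1) in auto)
    then show "?h \<in> ?N" using h(1) X(1) gc unfolding level_subgroup_def by auto
  next
    fix g h assume gh: "g \<in> ?N" "h \<in> ?N"
    obtain X where X: "X \<in> carrier_mat n n" "g = 1\<^sub>m n + e \<cdot>\<^sub>m X" using gh by (auto simp: level_subgroup_def)
    have hc: "h \<in> carrier_mat n n" using gh by (auto intro: GL_carrier level_subgroup_GL)
    have "g * h = h + e \<cdot>\<^sub>m (X * h)"
      using hc X by (simp add: add_mult_distrib_mat[of _ n n _ _ n] mult_smult_assoc_mat[of _ n n _ n])
    moreover have "X * h \<in> carrier_mat n n" using X hc by auto
    ultimately have "e dvd (g * h) $$ (i, j) - 1\<^sub>m n $$ (i, j)" if "i < n" "j < n" for i j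
    proof -
      assume eq: "g * h = h + e \<cdot>\<^sub>m (X * h)" and XH: "X * h \<in> carrier_mat n n"
      have "(g * h) $$ (i, j) - 1\<^sub>m n $$ (i, j) = (h $$ (i, j) - 1\<^sub>m n $$ (i, j)) + e * (X * h) $$ (i, j)"
        unfolding eq using XH hc that by (simp del: index_mult_mat)
      moreover have "e dvd h $$ (i, j) - 1\<^sub>m n $$ (i, j)" using gh that by (simp add: level_subgroup_iff)
      ultimately show ?thesis by (metis dvd_add dvd_triv_left)
    qed
    moreover have "g * h \<in> carrier (GL n)" using G.m_closed[of g h] gh level_subgroup_GL by auto
    ultimately show "g \<otimes>\<^bsub>GL n\<^esub> h \<in> ?N" by (simp add: level_subgroup_iff del: index_mult_mat)
  qed
  show ?thesis
  proof (rule G.normal_invI[OF sub])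
    fix g h :: "'a mat" assume g: "g \<in> carrier (GL n)" and h: "h \<in> ?N"
    obtain X where X: "X \<in> carrier_mat n n" "h = 1\<^sub>m n + e \<cdot>\<^sub>m X" using h by (auto simp: level_subgroup_def)
    let ?i = "inv\<^bsub>GL n\<^esub> g"
    note i = GL_inv[OF g] and gc = GL_carrier[OF g]
    have gX: "g * X \<in> carrier_mat n n" using gc X by auto
    have "g * h * ?i = g * ?i + e \<cdot>\<^sub>m (g * X * ?i)"
      unfolding X(2) using gc i(1) X(1) gX
      by (simp add: add_mult_distrib_mat[of _ n n _ _ n] mult_add_distrib_mat[of _ n n _ n]
          mult_smult_assoc_mat[of _ n n _ n] mult_smult_distrib[of _ n n _ n])
    then have "g * h * ?i = 1\<^sub>m n + e \<cdot>\<^sub>m (g * X * ?i)" using i by simp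
    moreover have "g * X * ?i \<in> carrier_mat n n" using gX i by auto
    moreover have "g * h * ?i \<in> carrier (GL n)"
      using G.m_closed[OF G.m_closed[OF g level_subgroup_GL[OF h]] G.inv_closed[OF g]] by simp
    ultimately show "g \<otimes>\<^bsub>GL n\<^esub> h \<otimes>\<^bsub>GL n\<^esub> ?i \<in> ?N" unfolding level_subgroup_def by auto
  qed
qed

lemma level_subgroup_coset:
  assumes g: "g \<in> carrier (GL n)" and h: "h \<in> carrier (GL n)"
    and eq: "\<And>i j. i < n \<Longrightarrow> j < n \<Longrightarrow> e dvd h $$ (i, j) - g $$ (i, j)"
  shows "h * inv\<^bsub>GL n\<^esub> g \<in> level_subgroup n e"
proof -
  interpret G: group "GL n" by (rule GL_group)
  let ?i = "inv\<^bsub>GL n\<^esub> g"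
  note gc = GL_carrier[OF g] and hc = GL_carrier[OF h] and i = GL_inv[OF g]
  obtain X where X: "X \<in> carrier_mat n n" "h = g + e \<cdot>\<^sub>m X"
    using mat_dvd_iff[OF hc gc, of e] eq by auto
  have "h * ?i = 1\<^sub>m n + e \<cdot>\<^sub>m (X * ?i)" unfolding X(2)
    using i gc X(1) by (simp add: add_mult_distrib_mat[of _ n n _ _ n] mult_smult_assoc_mat[of _ n n _ n])
  moreover have "X * ?i \<in> carrier_mat n n" using X i by auto
  moreover have "h * ?i \<in> carrier (GL n)" using G.m_closed[OF h G.inv_closed[OF g]] by simp
  ultimately show ?thesis unfolding level_subgroup_def by auto
qed

lemma finite_image_if_determined:
  assumes "finite (f ` A)" and "\<And>x y. x \<in> A \<Longrightarrow> y \<in> A \<Longrightarrow> f x = f y \<Longrightarrow> h x = h y"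
  shows "finite (h ` A)"
proof -
  have "h ` A \<subseteq> (\<lambda>k. h (inv_into A f k)) ` (f ` A)"
  proof
    fix y assume "y \<in> h ` A"
    then obtain x where x: "x \<in> A" "y = h x" by auto
    then have "h (inv_into A f (f x)) = h x"
      by (intro assms(2) inv_into_into f_inv_into_f) auto
    then show "y \<in> (\<lambda>k. h (inv_into A f k)) ` (f ` A)"
      using x by (intro image_eqI[of _ _ "f x"]) auto
  qed
  then show ?thesis using assms(1) finite_subset by blast
qed

lemma finite_mat_residues:
  fixes e :: "'a :: comm_ring_1"
  assumes "finite R" "\<And>x. \<exists>r\<in>R. e dvd x - r"
  shows "\<exists>f :: 'a mat \<Rightarrow> 'a mat. finite (range f) \<and>
    (\<forall>g h. f g = f h \<longrightarrow> (\<forall>i<n. \<forall>j<n. e dvd g $$ (i, j) - h $$ (i, j)))"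
proof -
  obtain r where r: "\<And>x. r x \<in> R" "\<And>x. e dvd x - r x" using assms(2) by metis
  define f where "f g = mat n n (\<lambda>(i, j). r (g $$ (i, j)))" for g :: "'a mat"
  let ?D = "PiE ({..<n} \<times> {..<n}) (\<lambda>_. R)"
  have "range f \<subseteq> (\<lambda>F. mat n n F) ` ?D"
  proof
    fix x assume "x \<in> range f"
    then obtain g where g: "x = f g" by auto
    have "x = mat n n (restrict (\<lambda>(i, j). r (g $$ (i, j))) ({..<n} \<times> {..<n}))"
      by (auto simp: g f_def intro!: eq_matI)
    moreover have "restrict (\<lambda>(i, j). r (g $$ (i, j))) ({..<n} \<times> {..<n}) \<in> ?D" using r by auto
    ultimately show "x \<in> (\<lambda>F. mat n n F) ` ?D" by blast
  qed
  moreover have "finite ?D" using assms(1) by (intro finite_PiE) auto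
  ultimately have "finite (range f)" using finite_subset by blast
  moreover have "e dvd g $$ (i, j) - h $$ (i, j)" if "f g = f h" "i < n" "j < n" for g h i j
  proof -
    have "r (g $$ (i, j)) = r (h $$ (i, j))"
      using arg_cong[OF that(1), of "\<lambda>A. A $$ (i, j)"] that by (simp add: f_def)
    then have "g $$ (i, j) - h $$ (i, j) = (g $$ (i, j) - r (g $$ (i, j))) - (h $$ (i, j) - r (h $$ (i, j)))"
      by simp
    then show ?thesis using r(2) by (metis dvd_diff)
  qed
  ultimately show ?thesis by (intro exI[of _ f]) auto
qed

lemma finite_level_cosets:
  fixes e :: "'a :: comm_ring_1"
  assumes "finite R" "\<And>x. \<exists>r\<in>R. e dvd x - r"
  shows "finite (carrier (GL n Mod level_subgroup n e))"
proof -
  interpret N: normal "level_subgroup n e" "GL n" by (rule level_subgroup_normal)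
  obtain f :: "'a mat \<Rightarrow> 'a mat" where f: "finite (range f)"
    "\<And>g h i j. f g = f h \<Longrightarrow> i < n \<Longrightarrow> j < n \<Longrightarrow> e dvd g $$ (i, j) - h $$ (i, j)"
    using finite_mat_residues[OF assms, of n] by blast
  have "finite ((\<lambda>g. level_subgroup n e #>\<^bsub>GL n\<^esub> g) ` carrier (GL n))"
  proof (rule finite_image_if_determined)
    show "finite (f ` carrier (GL n))" by (rule finite_subset[OF _ f(1)]) auto
    fix g h assume gh: "g \<in> carrier (GL n)" "h \<in> carrier (GL n)" "f g = f h"
    have "h * inv\<^bsub>GL n\<^esub> g \<in> level_subgroup n e"
      using gh by (intro level_subgroup_coset f(2)) auto
    then have "h \<in> level_subgroup n e #>\<^bsub>GL n\<^esub> g"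
      using N.rcos_module_rev[OF N.is_group gh(1,2)] by simp
    then show "level_subgroup n e #>\<^bsub>GL n\<^esub> g = level_subgroup n e #>\<^bsub>GL n\<^esub> h"
      using N.repr_independence[OF _ gh(1) N.subgroup_axioms] by simp
  qed
  moreover have "carrier (GL n Mod level_subgroup n e) = (\<lambda>g. level_subgroup n e #>\<^bsub>GL n\<^esub> g) ` carrier (GL n)"
    by (auto simp: FactGroup_def RCOSETS_def)
  ultimately show ?thesis by simp
qed

section \<open>Generation of congruence subgroups, and the topology\<close>

text \<open>The matrices of level \<open>e\<close> whose first \<open>k\<close> rows and columns vanish off the diagonal: the state of
  Gaussian elimination after \<open>k\<close> steps.\<close>

definition reduced_mat :: "nat \<Rightarrow> 'a :: comm_ring_1 \<Rightarrow> nat \<Rightarrow> 'a mat \<Rightarrow> bool" where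
  "reduced_mat n e k g \<longleftrightarrow> g \<in> level_subgroup n e \<and>
     (\<forall>i<n. \<forall>j<n. i \<noteq> j \<longrightarrow> i < k \<or> j < k \<longrightarrow> g $$ (i, j) = 0)"

lemma addrow_mat_level:
  assumes "k < n" "l < n" "k \<noteq> l"
  shows "addrow_mat n (e * c) k l \<in> level_subgroup n e"
  unfolding level_subgroup_iff using addrow_mat_GL[OF assms] assms by auto

lemma level_subgroup_mult:
  "g \<in> level_subgroup n e \<Longrightarrow> h \<in> level_subgroup n e \<Longrightarrow> g * h \<in> level_subgroup n e"
  using subgroup.m_closed[OF normal_imp_subgroup[OF level_subgroup_normal[of n e]], of g h] by simp

lemma reduced_mat_addrow:
  assumes g: "reduced_mat n e k g" and ab: "a < n" "b < n" "a \<noteq> b" "k \<le> a" "k \<le> b"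
  shows "reduced_mat n e k (addrow (e * c) a b g)"
    and "addrow (e * c) a b g = addrow_mat n (e * c) a b * g"
proof -
  have gc: "g \<in> carrier_mat n n" using g by (auto simp: reduced_mat_def intro: GL_carrier level_subgroup_GL)
  show eq: "addrow (e * c) a b g = addrow_mat n (e * c) a b * g" by (rule addrow_mat[OF gc ab(2)])
  have "addrow (e * c) a b g \<in> level_subgroup n e"
    unfolding eq using g addrow_mat_level[OF ab(1-3)] by (intro level_subgroup_mult) (auto simp: reduced_mat_def)
  then show "reduced_mat n e k (addrow (e * c) a b g)"
    using g ab gc by (auto simp: reduced_mat_def)
qed

lemma reduced_mat_addcol:
  assumes g: "reduced_mat n e k g" and ab: "a < n" "b < n" "a \<noteq> b" "k \<le> a" "k \<le> b"
  shows "reduced_mat n e k (addcol (e * c) a b g)"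
    and "addcol (e * c) a b g = g * addrow_mat n (e * c) b a"
proof -
  have gc: "g \<in> carrier_mat n n" using g by (auto simp: reduced_mat_def intro: GL_carrier level_subgroup_GL)
  show eq: "addcol (e * c) a b g = g * addrow_mat n (e * c) b a"
    by (rule addcol_mat[OF gc ab(2)])
  have "addcol (e * c) a b g \<in> level_subgroup n e"
    unfolding eq using g addrow_mat_level[of b n a] ab by (intro level_subgroup_mult) (auto simp: reduced_mat_def)
  then show "reduced_mat n e k (addcol (e * c) a b g)"
    using g ab gc by (auto simp: reduced_mat_def)
qed

context local_uniformizer
begin

text \<open>Over a local ring, the congruence subgroup of level \<open>e\<close> is generated by the elementary matrices
  with off-diagonal entry divisible by \<open>e\<close> and by the diagonal matrices of level \<open>e\<close>. For \<open>e = 1\<close> this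
  is the generation of the full linear group. The proof is Gaussian elimination.\<close>

lemma level_subgroup_induct:
  fixes S :: "'a mat set"
  assumes closed: "\<And>a b. a \<in> S \<Longrightarrow> b \<in> S \<Longrightarrow> a * b \<in> S"
    and elem: "\<And>k l c. k < n \<Longrightarrow> l < n \<Longrightarrow> k \<noteq> l \<Longrightarrow> addrow_mat n (e * c) k l \<in> S"
    and diag: "\<And>f. (\<And>i. i < n \<Longrightarrow> f i dvd 1) \<Longrightarrow> (\<And>i. i < n \<Longrightarrow> e dvd f i - 1) \<Longrightarrow> mat_diag n f \<in> S"
    and g: "g \<in> level_subgroup n e"
  shows "g \<in> S"
proof -
  have carr: "h \<in> carrier_mat n n" if "reduced_mat n e k h" for h k
    using that by (auto simp: reduced_mat_def intro: GL_carrier level_subgroup_GL)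
  have row: "h \<in> S" if h: "reduced_mat n e k h" and ab: "a < n" "b < n" "a \<noteq> b" "k \<le> a" "k \<le> b"
      and S: "addrow (e * c) a b h \<in> S" for h k a b c
  proof -
    have "addrow_mat n (e * - c) a b * addrow (e * c) a b h =
        (addrow_mat n (- (e * c)) a b * addrow_mat n (e * c) a b) * h"
      unfolding reduced_mat_addrow(2)[OF h ab] using carr[OF h] by (simp add: assoc_mult_mat[of _ n n _ n _ n])
    also have "\<dots> = h" using carr[OF h] ab by (simp add: addrow_mat_add addrow_mat_zero)
    finally show ?thesis using closed[OF elem[of a b "- c"] S] ab by simp
  qed
  have col: "h \<in> S" if h: "reduced_mat n e k h" and ab: "a < n" "b < n" "a \<noteq> b" "k \<le> a" "k \<le> b"
      and S: "addcol (e * c) a b h \<in> S" for h k a b c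
  proof -
    have "addcol (e * c) a b h * addrow_mat n (e * - c) b a =
        h * (addrow_mat n (e * c) b a * addrow_mat n (- (e * c)) b a)"
      unfolding reduced_mat_addcol(2)[OF h ab] using carr[OF h] by (simp add: assoc_mult_mat[of _ n n _ n _ n])
    also have "\<dots> = h" using carr[OF h] ab by (simp add: addrow_mat_add addrow_mat_zero)
    finally show ?thesis using closed[OF S elem[of b a "- c"]] ab by simp
  qed
  have "reduced_mat n e (n - m) h \<Longrightarrow> h \<in> S" for h m
  proof (induction m arbitrary: h)
    case (0 h)
    have hc: "h \<in> carrier_mat n n" by (rule carr[OF 0])
    have lev: "h \<in> level_subgroup n e" using 0 by (simp add: reduced_mat_def)
    obtain h' where h': "h' \<in> carrier_mat n n" "h * h' = 1\<^sub>m n"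
      using lev by (auto simp: level_subgroup_def GL_iff)
    have off: "h $$ (i, j) = 0" if "i < n" "j < n" "i \<noteq> j" for i j
      using 0 that by (auto simp: reduced_mat_def)
    have "h $$ (i, i) dvd 1" if i: "i < n" for i
    proof -
      have "1 = (h * h') $$ (i, i)" using h' i by simp
      also have "\<dots> = (\<Sum>k<n. h $$ (i, k) * h' $$ (k, i))"
        using hc h'(1) i by (simp add: scalar_prod_def atLeast0LessThan)
      also have "\<dots> = (\<Sum>k<n. if k = i then h $$ (i, i) * h' $$ (i, i) else 0)"
        using off i by (intro sum.cong) auto
      also have "\<dots> = h $$ (i, i) * h' $$ (i, i)" using i by simp
      finally show ?thesis by (metis dvd_triv_left)
    qed
    moreover have "e dvd h $$ (i, i) - 1" if "i < n" for i
    proof -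
      have "e dvd h $$ (i, i) - 1\<^sub>m n $$ (i, i)" using lev that unfolding level_subgroup_iff by blast
      then show ?thesis using that by simp
    qed
    ultimately have "mat_diag n (\<lambda>i. h $$ (i, i)) \<in> S" by (intro diag) auto
    moreover have "mat_diag n (\<lambda>i. h $$ (i, i)) = h"
      using hc off by (auto simp: mat_diag_def intro!: eq_matI)
    ultimately show ?case by simp
  next
    case (Suc m h)
    show ?case
    proof (cases "m < n")
      case False
      then show ?thesis using Suc.IH[of h] Suc.prems by simp
    next
      case True
      define k where "k = n - Suc m"
      have k: "k < n" "n - m = Suc k" using True by (auto simp: k_def)
      define cross where "cross h = {(i, j). i < n \<and> j < n \<and> i \<noteq> j \<and> (i = k \<or> j = k) \<and> h $$ (i, j) \<noteq> 0}"
        for h :: "'a mat"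
      have fin: "finite (cross h)" for h
        by (rule finite_subset[of _ "{..<n} \<times> {..<n}"]) (auto simp: cross_def)
      \<comment> \<open>When the pivot is a unit, each operation clears one entry of row or column \<open>k\<close>.\<close>
      have clear: "h \<in> S" if "reduced_mat n e k h" "h $$ (k, k) dvd 1" for h
        using that
      proof (induction "card (cross h)" arbitrary: h rule: less_induct)
        case (less h)
        note red = less.prems(1)
        have hc: "h \<in> carrier_mat n n" by (rule carr[OF red])
        obtain u where u: "h $$ (k, k) * u = 1" using less.prems(2) by (auto simp: dvd_def)
        have ge: "k \<le> i \<and> k \<le> j" if "i < n" "j < n" "i \<noteq> j" "h $$ (i, j) \<noteq> 0" for i j
          using red that unfolding reduced_mat_def by (meson not_le)
        have div: "\<exists>x. h $$ (i, j) = e * x" if "i < n" "j < n" "i \<noteq> j" for i j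
        proof -
          have "e dvd h $$ (i, j) - 1\<^sub>m n $$ (i, j)"
            using red that unfolding reduced_mat_def level_subgroup_iff by blast
          then show ?thesis using that by (auto simp: dvd_def)
        qed
        consider "cross h = {}" | i where "i < n" "i \<noteq> k" "h $$ (i, k) \<noteq> 0"
          | j where "j < n" "j \<noteq> k" "h $$ (k, j) \<noteq> 0"
          by (auto simp: cross_def)
        then show ?case
        proof cases
          case 1
          have "reduced_mat n e (n - m) h"
            unfolding reduced_mat_def
          proof (intro conjI allI impI)
            show "h \<in> level_subgroup n e" using red by (simp add: reduced_mat_def)
            fix i j assume ij: "i < n" "j < n" "i \<noteq> j" "i < n - m \<or> j < n - m"
            then consider "i < k \<or> j < k" | "i = k \<or> j = k" using k by fastforce
            then show "h $$ (i, j) = 0"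
            proof cases
              case 1 then show ?thesis using red ij unfolding reduced_mat_def by blast
            next
              case 2 then show ?thesis using \<open>cross h = {}\<close> ij unfolding cross_def by blast
            qed
          qed
          then show ?thesis by (rule Suc.IH)
        next
          case (2 i)
          obtain x where x: "h $$ (i, k) = e * x" using div[of i k] 2 k by auto
          define h' where "h' = addrow (e * (- x * u)) i k h"
          have ik: "i < n" "k < n" "i \<noteq> k" "k \<le> i" "k \<le> k" using 2 k ge[of i k] by auto
          have red': "reduced_mat n e k h'" unfolding h'_def by (rule reduced_mat_addrow(1)[OF red ik])
          have ent: "h' $$ (a, b) = (if a = i then e * (- x * u) * h $$ (k, b) + h $$ (a, b) else h $$ (a, b))"
            if "a < n" "b < n" for a b using that hc ik by (auto simp: h'_def)
          have "e * (- x * u) * h $$ (k, k) + e * x = e * x * (1 - h $$ (k, k) * u)"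
            by (simp add: algebra_simps)
          then have z: "h' $$ (i, k) = 0" using ent[of i k] ik u x by simp
          have "cross h' \<subseteq> cross h - {(i, k)}" using ent z ik by (auto simp: cross_def split: if_splits)
          moreover have "(i, k) \<in> cross h" using 2 k by (auto simp: cross_def)
          ultimately have "card (cross h') < card (cross h)"
            using fin[of h] by (intro psubset_card_mono) auto
          moreover have "h' $$ (k, k) dvd 1" using ent[of k k] ik less.prems(2) by simp
          ultimately have "h' \<in> S" using red' by (intro less.hyps)
          then show ?thesis unfolding h'_def by (rule row[OF red ik])
        next
          case (3 j)
          obtain x where x: "h $$ (k, j) = e * x" using div[of k j] 3 k by auto
          define h' where "h' = addcol (e * (- x * u)) j k h"
          have jk: "j < n" "k < n" "j \<noteq> k" "k \<le> j" "k \<le> k" using 3 k ge[of k j] by auto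
          have red': "reduced_mat n e k h'" unfolding h'_def by (rule reduced_mat_addcol(1)[OF red jk])
          have ent: "h' $$ (a, b) = (if b = j then e * (- x * u) * h $$ (a, k) + h $$ (a, b) else h $$ (a, b))"
            if "a < n" "b < n" for a b using that hc jk by (auto simp: h'_def)
          have "e * (- x * u) * h $$ (k, k) + e * x = e * x * (1 - h $$ (k, k) * u)"
            by (simp add: algebra_simps)
          then have z: "h' $$ (k, j) = 0" using ent[of k j] jk u x by simp
          have "cross h' \<subseteq> cross h - {(k, j)}" using ent z jk by (auto simp: cross_def split: if_splits)
          moreover have "(k, j) \<in> cross h" using 3 k by (auto simp: cross_def)
          ultimately have "card (cross h') < card (cross h)"
            using fin[of h] by (intro psubset_card_mono) auto
          moreover have "h' $$ (k, k) dvd 1" using ent[of k k] jk less.prems(2) by simp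
          ultimately have "h' \<in> S" using red' by (intro less.hyps)
          then show ?thesis unfolding h'_def by (rule col[OF red jk])
        qed
      qed
      have red: "reduced_mat n e k h" using Suc.prems by (simp add: k_def)
      have hc: "h \<in> carrier_mat n n" by (rule carr[OF red])
      show ?thesis
      proof (cases "h $$ (k, k) dvd 1")
        case True then show ?thesis by (rule clear[OF red])
      next
        case False
        have lev: "h \<in> level_subgroup n e" using red by (simp add: reduced_mat_def)
        then obtain h' where h': "h' \<in> carrier_mat n n" "h' * h = 1\<^sub>m n"
          by (auto simp: level_subgroup_def GL_iff)
        \<comment> \<open>The diagonal entry is \<open>1\<close> modulo \<open>e\<close> and not a unit, so \<open>e\<close> is a unit and any row may be added.\<close>
        have "e dvd h $$ (k, k) - 1\<^sub>m n $$ (k, k)" using lev k unfolding level_subgroup_iff by blast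
        moreover have "h $$ (k, k) + - 1 dvd 1" by (rule nonunit_add_unit[OF False]) simp
        ultimately have "e dvd 1" using k by (auto intro: dvd_trans)
        then obtain e' where e': "e * e' = 1" by (auto simp: dvd_def)
        have "\<exists>j<n. h $$ (j, k) dvd 1"
        proof (rule ccontr)
          assume no: "\<not> ?thesis"
          have "1 = (h' * h) $$ (k, k)" using h' k by simp
          also have "\<dots> = (\<Sum>j<n. h' $$ (k, j) * h $$ (j, k))"
            using hc h'(1) k by (simp add: scalar_prod_def atLeast0LessThan)
          finally have "1 = (\<Sum>j<n. h' $$ (k, j) * h $$ (j, k))" .
          moreover have "\<pi> dvd (\<Sum>j<n. h' $$ (k, j) * h $$ (j, k))"
            using no by (intro dvd_sum) (auto simp: unit_iff)
          ultimately show False using uniformizer_not_unit by simp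
        qed
        then obtain j where j: "j < n" "h $$ (j, k) dvd 1" by auto
        have "j \<noteq> k" using j False by auto
        moreover have "h $$ (j, k) \<noteq> 0" using j by auto
        ultimately have jk: "k < n" "j < n" "k \<noteq> j" "k \<le> k" "k \<le> j"
          using red k j unfolding reduced_mat_def by (auto simp: not_less[symmetric])
        have "addrow (e * e') k j h \<in> S"
        proof (rule clear)
          show "reduced_mat n e k (addrow (e * e') k j h)" by (rule reduced_mat_addrow(1)[OF red jk])
          have "addrow (e * e') k j h $$ (k, k) = h $$ (k, k) + h $$ (j, k)"
            using hc jk e' by simp
          then show "addrow (e * e') k j h $$ (k, k) dvd 1" using nonunit_add_unit[OF False j(2)] by simp
        qed
        then show ?thesis by (rule row[OF red jk])
      qed
    qed
  qed
  from this[of n g] show ?thesis using g by (simp add: reduced_mat_def)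
qed

end

lemma congruence_subgroup_eq_level:
  assumes "\<And>k. ideal_power class_ring (max_ideal class_ring) k = {x :: 'a :: idom. \<pi> ^ k dvd x}"
  shows "congruence_subgroup n k = level_subgroup n (\<pi> ^ k)"
proof -
  have "(g - 1\<^sub>m n) $$ (i, j) = g $$ (i, j) - 1\<^sub>m n $$ (i, j)" if "i < n" "j < n" for g :: "'a mat" and i j
    using that by simp
  then have "(\<forall>i<n. \<forall>j<n. \<pi> ^ k dvd (g - 1\<^sub>m n) $$ (i, j)) \<longleftrightarrow>
      (\<forall>i<n. \<forall>j<n. \<pi> ^ k dvd g $$ (i, j) - 1\<^sub>m n $$ (i, j))" for g :: "'a mat"
    by metis
  then show ?thesis unfolding congruence_subgroup_def assms set_eq_iff level_subgroup_iff by blast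
qed

lemma l_coset_mono: "H \<subseteq> K \<Longrightarrow> g <#\<^bsub>G\<^esub> H \<subseteq> g <#\<^bsub>G\<^esub> K"
  by (auto simp: l_coset_def)

lemma level_subgroup_mono:
  "e dvd e' \<Longrightarrow> level_subgroup n e' \<subseteq> level_subgroup n (e :: 'a :: comm_ring_1)"
  unfolding level_subgroup_iff subset_iff using dvd_trans by blast

text \<open>The cosets of the congruence subgroups form a basis, not just a subbasis, of the topology.\<close>

lemma openin_GL_topology_contains_coset:
  fixes \<pi> :: "'a :: idom"
  assumes pow: "\<And>k. ideal_power class_ring (max_ideal class_ring) k = {x :: 'a. \<pi> ^ k dvd x}"
    and U: "openin (GL_topology n) U" and g: "g \<in> U"
  shows "\<exists>k. g <#\<^bsub>GL n\<^esub> level_subgroup n (\<pi> ^ k) \<subseteq> U"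
proof -
  interpret G: group "GL n :: 'a mat monoid" by (rule GL_group)
  define \<B> where "\<B> = {h <#\<^bsub>GL n\<^esub> level_subgroup n (\<pi> ^ k) |h k. h \<in> carrier (GL n)}"
  have "generate_topology_on \<B> U"
    using U unfolding GL_topology_def congruence_subgroup_eq_level[OF pow] \<B>_def
    by (rule openin_topology_generated_by)
  then show ?thesis using g
  proof (induction arbitrary: g)
    case (Int a b)
    obtain k l where "g <#\<^bsub>GL n\<^esub> level_subgroup n (\<pi> ^ k) \<subseteq> a" "g <#\<^bsub>GL n\<^esub> level_subgroup n (\<pi> ^ l) \<subseteq> b"
      using Int by blast
    moreover have "level_subgroup n (\<pi> ^ max k l) \<subseteq> level_subgroup n (\<pi> ^ k)"
      "level_subgroup n (\<pi> ^ max k l) \<subseteq> level_subgroup n (\<pi> ^ l)"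
      by (intro level_subgroup_mono le_imp_power_dvd; simp)+
    ultimately show ?case by (intro exI[of _ "max k l"]) (meson Int_greatest l_coset_mono subset_trans)
  next
    case (Basis s)
    then obtain h k where s: "s = h <#\<^bsub>GL n\<^esub> level_subgroup n (\<pi> ^ k)" "h \<in> carrier (GL n)"
      unfolding \<B>_def by blast
    interpret N: normal "level_subgroup n (\<pi> ^ k)" "GL n" by (rule level_subgroup_normal)
    have "g <#\<^bsub>GL n\<^esub> level_subgroup n (\<pi> ^ k) = s"
      using G.l_repr_independence[OF _ s(2) N.subgroup_axioms, of g] Basis(2) s(1) by simp
    then show ?case by auto
  qed blast+
qed

lemma openin_GL_topology_if_contains_cosets:
  fixes \<pi> :: "'a :: idom"
  assumes pow: "\<And>k. ideal_power class_ring (max_ideal class_ring) k = {x :: 'a. \<pi> ^ k dvd x}"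
    and U: "U \<subseteq> carrier (GL n)" 
    and cos: "\<And>g. g \<in> U \<Longrightarrow> g <#\<^bsub>GL n\<^esub> level_subgroup n (\<pi> ^ k) \<subseteq> U"
  shows "openin (GL_topology n) U"
proof -
  interpret G: group "GL n :: 'a mat monoid" by (rule GL_group)
  interpret N: normal "level_subgroup n (\<pi> ^ k)" "GL n" by (rule level_subgroup_normal)
  have open_coset: "openin (GL_topology n) (g <#\<^bsub>GL n\<^esub> level_subgroup n (\<pi> ^ k))" if "g \<in> carrier (GL n)" for g
    unfolding GL_topology_def congruence_subgroup_eq_level[OF pow]
    by (rule topology_generated_by_Basis) (use that in blast)
  have mem: "g \<in> g <#\<^bsub>GL n\<^esub> level_subgroup n (\<pi> ^ k)" if "g \<in> carrier (GL n)" for g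
    unfolding l_coset_def by (rule UN_I[OF N.one_closed]) (use G.r_one[OF that] in simp)
  have "U = (\<Union>g\<in>U. g <#\<^bsub>GL n\<^esub> level_subgroup n (\<pi> ^ k))" using cos mem U by blast
  moreover have "openin (GL_topology n) (\<Union>g\<in>U. g <#\<^bsub>GL n\<^esub> level_subgroup n (\<pi> ^ k))"
    using open_coset U by (intro openin_Union) auto
  ultimately show ?thesis by simp
qed

lemma topspace_GL_topology: "topspace (GL_topology n :: 'a :: idom mat topology) = carrier (GL n)"
proof -
  interpret G: group "GL n :: 'a mat monoid" by (rule GL_group)
  have "1\<^sub>m n \<in> (congruence_subgroup n 0 :: 'a mat set)"
    using G.one_closed by (auto simp: congruence_subgroup_def ideal_power_def ideals_set_def)
  moreover have "g * 1\<^sub>m n = g" if "g \<in> carrier (GL n)" for g :: "'a mat"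
    using GL_carrier[OF that] by simp
  ultimately have "g \<in> g <#\<^bsub>GL n\<^esub> congruence_subgroup n 0" if "g \<in> carrier (GL n)" for g :: "'a mat"
    using that unfolding l_coset_def by (intro UN_I[of "1\<^sub>m n"]) simp_all
  moreover have "g <#\<^bsub>GL n\<^esub> congruence_subgroup n k \<subseteq> carrier (GL n)" if "g \<in> carrier (GL n)" for g :: "'a mat" and k
    using that by (intro G.l_coset_subset_G) (auto simp: congruence_subgroup_def)
  ultimately show ?thesis unfolding GL_topology_def topology_generated_by_topspace by blast
qed

section \<open>The action of elementary matrices and of congruence subgroups\<close>

lemma GL_hom:
  assumes "group G" "\<rho> \<in> hom G (GL d)"
  shows "\<And>g. g \<in> carrier G \<Longrightarrow> \<rho> g \<in> carrier_mat d d"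
    and "\<And>g h. g \<in> carrier G \<Longrightarrow> h \<in> carrier G \<Longrightarrow> \<rho> (g \<otimes>\<^bsub>G\<^esub> h) = \<rho> g * \<rho> h"
    and "\<rho> \<one>\<^bsub>G\<^esub> = 1\<^sub>m d"
  using hom_in_carrier[OF assms(2)] hom_mult[OF assms(2)] hom_one[OF assms(2,1) GL_group]
  by (auto intro: GL_carrier)

text \<open>A continuous representation maps a small congruence subgroup to a small neighbourhood of the
  identity, hence to the identity.\<close>

lemma continuous_rep_open_kernel:
  fixes \<pi> :: "'a :: idom"
  assumes pow: "\<And>k. ideal_power class_ring (max_ideal class_ring) k = {x :: 'a. \<pi> ^ k dvd x}"
    and \<rho>: "continuous_rep (GL n :: 'a mat monoid) (GL_topology n) d \<rho>" and d: "d > 0"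
  shows "\<exists>k. \<forall>h\<in>level_subgroup n (\<pi> ^ k). \<rho> h = 1\<^sub>m d"
proof -
  interpret G: group "GL n :: 'a mat monoid" by (rule GL_group)
  have hom: "\<rho> \<in> hom (GL n) (GL d)"
    and cont: "\<And>i j. i < d \<Longrightarrow> j < d \<Longrightarrow> continuous_map (GL_topology n) euclidean (\<lambda>g. \<rho> g $$ (i, j))"
    using \<rho> by (auto simp: continuous_rep_def)
  note \<rho>h = GL_hom[OF G.is_group hom]
  define \<epsilon> where "\<epsilon> = 1 / (2 * real d)"
  have \<epsilon>: "\<epsilon> > 0" using d by (simp add: \<epsilon>_def)
  define V where "V i j = {z. cmod (z - 1\<^sub>m d $$ (i, j)) < \<epsilon>}" for i j
  define U where "U i j = {g \<in> topspace (GL_topology n :: 'a mat topology). \<rho> g $$ (i, j) \<in> V i j}" for i j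
  have V: "open (V i j)" for i j unfolding V_def by (intro open_Collect_less continuous_intros)
  have U: "openin (GL_topology n) (U i j)" if "i < d" "j < d" for i j
    unfolding U_def by (rule openin_continuous_map_preimage[OF cont[OF that]]) (use V in simp)
  let ?F = "(\<lambda>(i, j). U i j) ` ({..<d} \<times> {..<d})"
  have "openin (GL_topology n) (\<Inter>?F)"
    using U d by (intro openin_Inter) auto
  moreover have "1\<^sub>m n \<in> \<Inter>?F"
  proof -
    have "\<rho> (1\<^sub>m n) = 1\<^sub>m d" using \<rho>h(3) by simp
    moreover have "1\<^sub>m n \<in> topspace (GL_topology n :: 'a mat topology)"
      using G.one_closed by (simp add: topspace_GL_topology)
    ultimately show ?thesis using \<epsilon> by (auto simp: U_def V_def)
  qed
  ultimately obtain k where k: "1\<^sub>m n <#\<^bsub>GL n\<^esub> level_subgroup n (\<pi> ^ k) \<subseteq> \<Inter>?F"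
    using openin_GL_topology_contains_coset[OF pow, of n] by blast
  have mem: "h \<in> \<Inter>?F" if h: "h \<in> level_subgroup n (\<pi> ^ k)" for h
  proof -
    have "h = 1\<^sub>m n \<otimes>\<^bsub>GL n\<^esub> h" using GL_carrier[OF level_subgroup_GL[OF h]] by simp
    then have "h \<in> 1\<^sub>m n <#\<^bsub>GL n\<^esub> level_subgroup n (\<pi> ^ k)" using h unfolding l_coset_def by blast
    then show ?thesis using k by blast
  qed
  have "\<rho> h = 1\<^sub>m d" if h: "h \<in> level_subgroup n (\<pi> ^ k)" for h
  proof (rule no_small_square_closed_sets[OF d, of "\<rho> ` level_subgroup n (\<pi> ^ k)"])
    show "\<rho> ` level_subgroup n (\<pi> ^ k) \<subseteq> carrier_mat d d"
      using \<rho>h(1) level_subgroup_GL by blast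
    show "\<rho> h \<in> \<rho> ` level_subgroup n (\<pi> ^ k)" using h by simp
  next
    fix x assume "x \<in> \<rho> ` level_subgroup n (\<pi> ^ k)"
    then obtain h where h: "h \<in> level_subgroup n (\<pi> ^ k)" "x = \<rho> h" by auto
    have "h * h \<in> level_subgroup n (\<pi> ^ k)"
      using subgroup.m_closed[OF normal_imp_subgroup[OF level_subgroup_normal] h(1) h(1)] by simp
    moreover have "x * x = \<rho> (h * h)" using \<rho>h(2)[of h h] level_subgroup_GL[OF h(1)] h(2) by simp
    ultimately show "x * x \<in> \<rho> ` level_subgroup n (\<pi> ^ k)" by simp
  next
    fix x i j assume "x \<in> \<rho> ` level_subgroup n (\<pi> ^ k)" and ij: "i < d" "j < d"
    then obtain h where h: "h \<in> level_subgroup n (\<pi> ^ k)" "x = \<rho> h" by auto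
    have "h \<in> U i j" using mem[OF h(1)] ij by blast
    then show "cmod (x $$ (i, j) - 1\<^sub>m d $$ (i, j)) \<le> 1 / (2 * real d)"
      by (simp add: U_def V_def h(2) \<epsilon>_def)
  qed
  then show ?thesis by blast
qed

lemma smult_vec_cancel:
  fixes w :: "'a :: field vec"
  assumes "a \<cdot>\<^sub>v w = b \<cdot>\<^sub>v w" "w \<in> carrier_vec d" "w \<noteq> 0\<^sub>v d"
  shows "a = b"
proof -
  obtain i where i: "i < d" "w $ i \<noteq> 0"
  proof (rule ccontr)
    assume "\<not> thesis"
    then have "w = 0\<^sub>v d" using assms(2) that by (intro eq_vecI) auto
    then show False using assms(3) by simp
  qed
  show ?thesis using arg_cong[OF assms(1), of "\<lambda>v. v $ i"] i assms(2) by simp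
qed

text \<open>The root subgroup \<open>B\<close> at position \<open>(a, b)\<close> acts by commuting matrices of finite order. A diagonal
  matrix rescales it by \<open>u\<close>, and so permutes the at most \<open>d\<close> joint weights. Hence \<open>u\<close> to the power \<open>d!\<close>
  fixes every weight \<open>\<psi>\<close>, that is, \<open>\<psi> ((u\<^sup>N - 1) c) = 1\<close> with \<open>N = d!\<close>. The conclusion does not involve the
  level \<open>k\<close>, which depends on \<open>\<rho>\<close>.\<close>

lemma (in local_uniformizer) elementary_kernel:
  assumes hom: "\<rho> \<in> hom (GL n :: 'a mat monoid) (GL d :: complex mat monoid)"
    and ker: "\<And>h. h \<in> level_subgroup n (\<pi> ^ k) \<Longrightarrow> \<rho> h = 1\<^sub>m d"
    and uv: "u * v = 1" and ab: "a < n" "b < n" "a \<noteq> b"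
  shows "\<rho> (addrow_mat n ((u ^ fact d - 1) * c) a b) = 1\<^sub>m d"
proof -
  interpret G: group "GL n :: 'a mat monoid" by (rule GL_group)
  note \<rho>h = GL_hom[OF G.is_group hom]
  define x where "x c = (addrow_mat n c a b :: 'a mat)" for c
  define B where "B c = \<rho> (x c)" for c
  have xG: "x c \<in> carrier (GL n)" for c unfolding x_def by (rule addrow_mat_GL[OF ab])
  have Bc: "B c \<in> carrier_mat d d" for c unfolding B_def by (rule \<rho>h(1)[OF xG])
  have Badd: "B (c + c') = B c * B c'" for c c'
    using \<rho>h(2)[OF xG xG, of c c'] addrow_mat_add[OF ab, of c c'] by (simp add: B_def x_def)
  have B0: "B 0 = 1\<^sub>m d" using \<rho>h(3) ab by (simp add: B_def x_def addrow_mat_zero)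
  have Bcong: "B c = B c'" if dvd: "\<pi> ^ k dvd c - c'" for c c'
  proof -
    obtain y where y: "c - c' = \<pi> ^ k * y" using dvd by (auto simp: dvd_def)
    have "B (c - c') = 1\<^sub>m d"
      unfolding y B_def x_def by (intro ker addrow_mat_level ab)
    then have "B ((c - c') + c') = B c'" unfolding Badd using left_mult_one_mat[OF Bc] by simp
    then show ?thesis by simp
  qed
  have fin: "finite (range B)"
  proof -
    obtain R where R: "finite R" "\<And>x. \<exists>r\<in>R. \<pi> ^ k dvd x - r" using finite_residues_power[of k] by auto
    have "range B \<subseteq> B ` R"
    proof
      fix y assume "y \<in> range B"
      then obtain c where "y = B c" by auto
      moreover obtain r where "r \<in> R" "\<pi> ^ k dvd c - r" using R(2) by auto
      ultimately show "y \<in> B ` R" using Bcong by auto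
    qed
    then show ?thesis using R(1) finite_surj by blast
  qed
  have Bpow: "B c ^\<^sub>m m = B (of_nat m * c)" for c m
  proof (induction m)
    case 0 show ?case using Bc[of c] by (simp add: B0)
  next
    case (Suc m)
    have "B (of_nat (Suc m) * c) = B (of_nat m * c + c)" by (simp add: algebra_simps)
    then show ?case by (simp add: Badd Suc)
  qed
  have ord: "\<exists>m>0. B c ^\<^sub>m m = 1\<^sub>m d" for c
  proof -
    have "finite (range (\<lambda>i. B (of_nat i * c)))" by (rule finite_subset[OF _ fin]) auto
    then have "\<not> inj (\<lambda>i. B (of_nat i * c))" using finite_imageD infinite_UNIV_nat by blast
    then obtain i j where ij: "B (of_nat i * c) = B (of_nat j * c)" "i < j"
      unfolding inj_def by (metis linorder_neqE_nat)
    have e1: "of_nat (j - i) * c = - (of_nat i * c) + of_nat j * c"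
      using ij(2) by (simp add: of_nat_diff algebra_simps)
    have e2: "- (of_nat i * c) + of_nat i * c = 0" by simp
    have "B c ^\<^sub>m (j - i) = B (- (of_nat i * c)) * B (of_nat j * c)"
      unfolding Bpow e1 by (rule Badd)
    also have "\<dots> = B 0" unfolding ij(1)[symmetric] Badd[symmetric] e2 ..
    finally show ?thesis using ij(2) B0 by (intro exI[of _ "j - i"]) auto
  qed
  define f where "f i = (if i = a then v else 1)" for i
  define f' where "f' i = (if i = a then u else 1)" for i
  have f: "mat_diag n f \<in> carrier (GL n)" "mat_diag n f' \<in> carrier (GL n)"
    using uv by (auto intro!: mat_diag_GL simp: f_def f'_def dvd_def) (metis mult.commute)+
  define E where "E = \<rho> (mat_diag n f)"
  define E' where "E' = \<rho> (mat_diag n f')"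
  have E: "E \<in> carrier_mat d d" "E' \<in> carrier_mat d d" unfolding E_def E'_def using f \<rho>h(1) by auto
  have "mat_diag n f' * mat_diag n f = 1\<^sub>m n"
    unfolding mat_diag_mult using uv by (auto simp: f_def f'_def mat_diag_def intro!: eq_matI)
  then have E'E: "E' * E = 1\<^sub>m d" using \<rho>h(2)[OF f(2,1)] \<rho>h(3) by (simp add: E_def E'_def)
  have EB: "E * B (u * c) = B c * E" for c
  proof -
    have "f a * (u * c) = c * f b" using uv ab by (simp add: f_def mult_ac flip: mult.assoc)
    then have "mat_diag n f * x (u * c) = x c * mat_diag n f"
      unfolding x_def by (rule mat_diag_addrow_mat[OF ab])
    then show ?thesis using \<rho>h(2)[OF f(1) xG, of "u * c"] \<rho>h(2)[OF xG f(1), of c] by (simp add: E_def B_def)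
  qed
  define e where "e = u ^ fact d - 1"
  have "B (e * c) - 1\<^sub>m d = 0\<^sub>m d d"
  proof (rule mat_eq_zero_if_kills_joint_eigenvectors[OF fin])
    show "range B \<subseteq> carrier_mat d d" using Bc by auto
    show "A * A' = A' * A" if "A \<in> range B" "A' \<in> range B" for A A'
      using that by (auto simp flip: Badd simp: add.commute)
    show "\<exists>m>0. A ^\<^sub>m m = 1\<^sub>m d" if "A \<in> range B" for A using that ord by auto
    show "B (e * c) - 1\<^sub>m d \<in> carrier_mat d d" by (rule minus_carrier_mat) simp
    fix w assume w: "joint_eigenvector d (range B) w"
    then have wc: "w \<in> carrier_vec d" "w \<noteq> 0\<^sub>v d" by (auto simp: joint_eigenvector_def)
    have "\<forall>c. \<exists>l. B c *\<^sub>v w = l \<cdot>\<^sub>v w" using w by (auto simp: joint_eigenvector_def)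
    then obtain \<psi> where \<psi>: "\<And>c. B c *\<^sub>v w = \<psi> c \<cdot>\<^sub>v w" by metis
    have \<psi>add: "\<psi> (c + c') = \<psi> c * \<psi> c'" for c c'
    proof (rule smult_vec_cancel[OF _ wc])
      have "\<psi> (c + c') \<cdot>\<^sub>v w = B c *\<^sub>v (B c' *\<^sub>v w)"
        unfolding \<psi>[symmetric] Badd by (rule assoc_mult_mat_vec[OF Bc Bc wc(1)])
      also have "\<dots> = \<psi> c' \<cdot>\<^sub>v (\<psi> c \<cdot>\<^sub>v w)" unfolding \<psi> using mult_mat_vec[OF Bc wc(1)] \<psi> by simp
      finally show "\<psi> (c + c') \<cdot>\<^sub>v w = (\<psi> c * \<psi> c') \<cdot>\<^sub>v w" by (simp add: smult_smult_assoc mult.commute)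
    qed
    have "\<psi> 0 = 1"
      by (rule smult_vec_cancel[OF _ wc]) (use \<psi>[of 0] wc(1) in \<open>simp add: B0\<close>)
    then have \<psi>0: "\<psi> c \<noteq> 0" for c using \<psi>add[of c "- c"] by auto
    define W where "W t = ((\<lambda>w. E *\<^sub>v w) ^^ t) w" for t
    have W: "W t \<in> carrier_vec d \<and> W t \<noteq> 0\<^sub>v d \<and> (\<forall>c. B c *\<^sub>v W t = \<psi> (u ^ t * c) \<cdot>\<^sub>v W t)" for t
    proof (induction t)
      case 0 show ?case using wc \<psi> by (simp add: W_def)
    next
      case (Suc t)
      have WS: "W (Suc t) = E *\<^sub>v W t" by (simp add: W_def)
      have Wc: "W t \<in> carrier_vec d" using Suc by simp
      have "W (Suc t) \<noteq> 0\<^sub>v d"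
      proof
        assume "W (Suc t) = 0\<^sub>v d"
        then have "E' *\<^sub>v (E *\<^sub>v W t) = 0\<^sub>v d" using mult_mat_zero_vec[OF E(2)] WS by simp
        then have "W t = 0\<^sub>v d" using assoc_mult_mat_vec[OF E(2,1) Wc] E'E Wc by simp
        then show False using Suc by simp
      qed
      moreover have "B c *\<^sub>v W (Suc t) = \<psi> (u ^ Suc t * c) \<cdot>\<^sub>v W (Suc t)" for c
      proof -
        have "B c *\<^sub>v (E *\<^sub>v W t) = E *\<^sub>v (B (u * c) *\<^sub>v W t)"
          using assoc_mult_mat_vec[OF Bc E(1) Wc] assoc_mult_mat_vec[OF E(1) Bc Wc] EB by metis
        also have "B (u * c) *\<^sub>v W t = \<psi> (u ^ t * (u * c)) \<cdot>\<^sub>v W t" using Suc by blast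
        also have "E *\<^sub>v \<dots> = \<psi> (u ^ t * (u * c)) \<cdot>\<^sub>v (E *\<^sub>v W t)" by (rule mult_mat_vec[OF E(1) Wc])
        finally show ?thesis by (simp add: WS mult_ac)
      qed
      moreover have "W (Suc t) \<in> carrier_vec d" unfolding WS by (rule mult_mat_vec_carrier[OF E(1) Wc])
      ultimately show ?case by blast
    qed
    obtain s t where st: "s < t" "t \<le> d" "(\<lambda>c. \<psi> (u ^ s * c)) = (\<lambda>c. \<psi> (u ^ t * c))"
      using joint_weights_repeat[of B d W "\<lambda>t c. \<psi> (u ^ t * c)"] W Bc by blast
    define m where "m = t - s"
    have "\<psi> (u ^ m * c) = \<psi> c" for c
    proof -
      have 1: "u ^ s * (v ^ s * c) = c" using uv by (simp flip: mult.assoc power_mult_distrib)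
      have 2: "u ^ t * (v ^ s * c) = u ^ m * (u ^ s * (v ^ s * c))"
        using st(1) by (simp add: m_def flip: mult.assoc power_add)
      show ?thesis using fun_cong[OF st(3), of "v ^ s * c"] unfolding 2 1 by (rule sym)
    qed
    then have "\<psi> (u ^ (m * q) * c) = \<psi> c" for q c
      by (induction q) (simp_all add: power_add mult.assoc)
    moreover have "m dvd fact d" using st by (intro dvd_fact) (auto simp: m_def)
    then obtain q where "fact d = m * q" by (elim dvdE)
    ultimately have "\<psi> (u ^ fact d * c) = \<psi> c" for c by metis
    then have "\<psi> (e * c + c) = \<psi> c" by (simp add: e_def algebra_simps)
    then have "\<psi> (e * c) = 1" using \<psi>add[of "e * c" c] \<psi>0[of c] by simp
    then have "B (e * c) *\<^sub>v w = w" using \<psi>[of "e * c"] by simp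
    then show "(B (e * c) - 1\<^sub>m d) *\<^sub>v w = 0\<^sub>v d"
      using minus_mult_distrib_mat_vec[OF Bc one_carrier_mat wc(1), of "e * c"] wc by simp
  qed
  then have "(B (e * c) - 1\<^sub>m d) $$ (i, j) = 0" if "i < d" "j < d" for i j using that by simp
  then have "B (e * c) = 1\<^sub>m d" using Bc[of "e * c"] by (intro eq_matI) auto
  then show ?thesis by (simp add: B_def x_def e_def)
qed

text \<open>Modulo the kernel, an element of level \<open>e\<close> is a product of diagonal matrices of level \<open>e\<close>. These
  commute with diagonal matrices, and with elementary matrices up to elementary matrices with entry
  divisible by \<open>e\<close>, which lie in the kernel.\<close>

lemma (in local_uniformizer) level_subgroup_central:
  assumes hom: "\<rho> \<in> hom (GL n :: 'a mat monoid) (GL d :: complex mat monoid)"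
    and ker: "\<And>a b c. a < n \<Longrightarrow> b < n \<Longrightarrow> a \<noteq> b \<Longrightarrow> \<rho> (addrow_mat n (e * c) a b) = 1\<^sub>m d"
    and h: "h \<in> level_subgroup n e" and g: "g \<in> carrier (GL n)"
  shows "\<rho> h * \<rho> g = \<rho> g * \<rho> h"
proof -
  interpret G: group "GL n :: 'a mat monoid" by (rule GL_group)
  note \<rho>h = GL_hom[OF G.is_group hom]
  have mult: "x * y \<in> carrier (GL n)" if "x \<in> carrier (GL n)" "y \<in> carrier (GL n)" for x y :: "'a mat"
    using G.m_closed[OF that] by simp
  have \<rho>mult: "\<rho> (x * y) = \<rho> x * \<rho> y" if "x \<in> carrier (GL n)" "y \<in> carrier (GL n)" for x y
    using \<rho>h(2)[OF that] by simp
  define C where "C h = {g \<in> carrier (GL n). \<rho> h * \<rho> g = \<rho> g * \<rho> h}" for h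
  have C_closed: "x * y \<in> C h" if h: "h \<in> carrier (GL n)" and xy: "x \<in> C h" "y \<in> C h" for h x y
  proof -
    have G: "x \<in> carrier (GL n)" "y \<in> carrier (GL n)"
      and comm: "\<rho> h * \<rho> x = \<rho> x * \<rho> h" "\<rho> h * \<rho> y = \<rho> y * \<rho> h" using xy by (auto simp: C_def)
    note car = \<rho>h(1)[OF h] \<rho>h(1)[OF G(1)] \<rho>h(1)[OF G(2)]
    have "\<rho> h * (\<rho> x * \<rho> y) = (\<rho> h * \<rho> x) * \<rho> y" using car by (simp add: assoc_mult_mat[of _ d d _ d _ d])
    also have "\<dots> = \<rho> x * (\<rho> h * \<rho> y)" unfolding comm(1) using car by (simp add: assoc_mult_mat[of _ d d _ d _ d])
    also have "\<dots> = \<rho> x * \<rho> y * \<rho> h" unfolding comm(2) using car by (simp add: assoc_mult_mat[of _ d d _ d _ d])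
    finally show ?thesis using G by (simp add: C_def mult \<rho>mult)
  qed
  have C_sym: "x \<in> C y" if "x \<in> carrier (GL n)" "y \<in> C x" for x y using that by (auto simp: C_def)
  have diag: "g \<in> C (mat_diag n f)"
    if fu: "\<And>i. i < n \<Longrightarrow> f i dvd 1" and fe: "\<And>i. i < n \<Longrightarrow> e dvd f i - 1" and g: "g \<in> carrier (GL n)" for f g
  proof (rule level_subgroup_induct[where e = 1])
    have D: "mat_diag n f \<in> carrier (GL n)" by (rule mat_diag_GL[OF fu])
    show "x * y \<in> C (mat_diag n f)" if "x \<in> C (mat_diag n f)" "y \<in> C (mat_diag n f)" for x y
      by (rule C_closed[OF D that])
    show "g \<in> level_subgroup n 1" using g by (simp add: level_subgroup_iff)
    fix k l c assume kl: "k < n" "l < n" "k \<noteq> l"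
    obtain z where z: "f l * z = 1" using fu[OF kl(2)] by (auto elim: dvdE)
    have "e dvd (f k - 1) - (f l - 1)" using fe[OF kl(1)] fe[OF kl(2)] by (rule dvd_diff)
    then obtain y where y: "f k - f l = e * y" by (auto simp: dvd_def)
    define b where "b = c + e * (y * z * c)"
    have "f l * b = c * f l + (f k - f l) * (f l * z) * c" by (simp add: b_def y algebra_simps)
    then have "f k * c = b * f l" unfolding z by (simp add: algebra_simps)
    then have "mat_diag n f * addrow_mat n c k l = addrow_mat n b k l * mat_diag n f"
      by (rule mat_diag_addrow_mat[OF kl])
    moreover have "addrow_mat n b k l = addrow_mat n c k l * addrow_mat n (e * (y * z * c)) k l"
      unfolding b_def by (rule addrow_mat_add[OF kl, symmetric])
    moreover note ker[OF kl, of "y * z * c"] \<rho>h(1)[OF addrow_mat_GL[OF kl, of c]]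
    ultimately have "\<rho> (mat_diag n f) * \<rho> (addrow_mat n c k l) = \<rho> (addrow_mat n c k l) * \<rho> (mat_diag n f)"
      using \<rho>mult[OF D addrow_mat_GL[OF kl, of c]] \<rho>mult[OF addrow_mat_GL[OF kl, of b] D]
        \<rho>mult[OF addrow_mat_GL[OF kl, of c] addrow_mat_GL[OF kl, of "e * (y * z * c)"]] by simp
    then show "addrow_mat n (1 * c) k l \<in> C (mat_diag n f)" using addrow_mat_GL[OF kl] by (simp add: C_def)
  next
    have D: "mat_diag n f \<in> carrier (GL n)" by (rule mat_diag_GL[OF fu])
    fix f' assume f': "\<And>i. i < n \<Longrightarrow> f' i dvd (1 :: 'a)"
    have D': "mat_diag n f' \<in> carrier (GL n)" by (rule mat_diag_GL[OF f'])
    have "mat_diag n f * mat_diag n f' = mat_diag n f' * mat_diag n f"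
      unfolding mat_diag_mult by (simp add: mult.commute)
    then show "mat_diag n f' \<in> C (mat_diag n f)"
      using \<rho>mult[OF D D'] \<rho>mult[OF D' D] D' by (simp add: C_def)
  qed
  have "h \<in> C g"
  proof (rule level_subgroup_induct[OF C_closed[OF g] _ _ h])
    fix k l c assume kl: "k < n" "l < n" "k \<noteq> l"
    show "addrow_mat n (e * c) k l \<in> C g"
      using ker[OF kl] addrow_mat_GL[OF kl, of "e * c"] \<rho>h(1)[OF g] by (simp add: C_def)
  next
    fix f assume f: "\<And>i. i < n \<Longrightarrow> f i dvd (1 :: 'a)" "\<And>i. i < n \<Longrightarrow> e dvd f i - 1"
    show "mat_diag n f \<in> C g" by (rule C_sym[OF mat_diag_GL[OF f(1)] diag[OF f g]])
  qed
  then show ?thesis by (simp add: C_def)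
qed

section \<open>Projective equivalence and twist equivalence\<close>

text \<open>Isomorphism of \<open>\<rho>\<close> and \<open>\<sigma>\<close> up to scalars. For representations the scalars \<open>c\<close> form a character
  of \<open>G\<close>, but the definition does not ask for this.\<close>

definition projectively_equivalent ::
    "('g, 'b) monoid_scheme \<Rightarrow> nat \<Rightarrow> ('g \<Rightarrow> complex mat) \<Rightarrow> ('g \<Rightarrow> complex mat) \<Rightarrow> bool" where
  "projectively_equivalent G d \<rho> \<sigma> \<longleftrightarrow>
     (\<exists>P\<in>carrier (GL d). \<forall>g\<in>carrier G. \<exists>c. P * \<rho> g = c \<cdot>\<^sub>m (\<sigma> g * P))"

lemma irreducible_rep_scaled:
  assumes irr: "irreducible_rep G d \<rho>"
    and \<rho>: "\<And>g. g \<in> carrier G \<Longrightarrow> \<exists>p\<in>carrier F. \<exists>c. \<rho> g = c \<cdot>\<^sub>m T p"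
    and T: "\<And>p. p \<in> carrier F \<Longrightarrow> T p \<in> carrier_mat d d"
  shows "irreducible_rep F d T"
  unfolding irreducible_rep_def
proof (intro conjI allI impI)
  show "d > 0" using irr by (simp add: irreducible_rep_def)
  fix W assume W: "VectorSpace.subspace class_ring W (module_vec TYPE(complex) d) \<and>
    (\<forall>p\<in>carrier F. \<forall>w\<in>W. T p *\<^sub>v w \<in> W)"
  have "\<rho> g *\<^sub>v w \<in> W" if g: "g \<in> carrier G" and w: "w \<in> W" for g w
  proof -
    obtain p c where p: "p \<in> carrier F" "\<rho> g = c \<cdot>\<^sub>m T p" using \<rho>[OF g] by blast
    have wc: "w \<in> carrier_vec d" using subspace_carrier[of W d] W w by blast
    have "\<rho> g *\<^sub>v w = c \<cdot>\<^sub>v (T p *\<^sub>v w)"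
      unfolding p(2) using T[OF p(1)] wc by (intro eq_vecI) (auto simp: scalar_prod_def sum_distrib_left mult_ac)
    then show ?thesis using W p(1) w subspace_smult_closed[of W d "T p *\<^sub>v w" c] by simp
  qed
  then show "W = {0\<^sub>v d} \<or> W = carrier_vec d" using irr W unfolding irreducible_rep_def by blast
qed

lemma smult_mat_cancel:
  fixes A :: "complex mat"
  assumes "a \<cdot>\<^sub>m A = b \<cdot>\<^sub>m A" "A \<in> carrier_mat d d" "det A \<noteq> 0" "d > 0"
  shows "a = b"
proof -
  obtain B where B: "B \<in> carrier_mat d d" "A * B = 1\<^sub>m d" using obtain_inverse_mat[OF assms(2,3)] by blast
  have "a \<cdot>\<^sub>m (A * B) = b \<cdot>\<^sub>m (A * B)"
    using assms(1) mult_smult_assoc_mat[OF assms(2) B(1)] by metis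
  then have "(a \<cdot>\<^sub>m 1\<^sub>m d) $$ (0, 0) = (b \<cdot>\<^sub>m 1\<^sub>m d) $$ (0, 0)" by (simp add: B(2))
  then show ?thesis using assms(4) by simp
qed

lemma complex_root_exists:
  assumes "d > 0" shows "\<exists>c :: complex. c ^ d = z"
proof (cases "z = 0")
  case True then show ?thesis using assms by (intro exI[of _ 0]) (simp add: power_0_left)
next
  case False
  then have "card {c. c ^ d = z} \<noteq> 0" using card_nth_roots[OF False assms] assms by simp
  then have "{c. c ^ d = z} \<noteq> {}" by (metis card.empty)
  then show ?thesis by blast
qed

text \<open>If \<open>N\<close> acts by scalars, rescaling the values of \<open>\<rho>\<close> on coset representatives to determinant \<open>1\<close>
  gives a projective representation \<open>T\<close> of \<open>G / N\<close>. Taking determinants shows that its multiplier takes values in the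
  \<open>d\<close>-th roots of unity, so that only finitely many multipliers occur when \<open>G / N\<close> is finite.\<close>

lemma projective_rep_of_quotient:
  assumes N: "N \<lhd> G" and hom: "\<rho> \<in> hom G (GL d)" and irr: "irreducible_rep G d \<rho>"
    and scalar: "\<And>h. h \<in> N \<Longrightarrow> \<exists>k. \<rho> h = k \<cdot>\<^sub>m 1\<^sub>m d"
  shows "\<exists>T. \<exists>\<alpha>\<in>carrier (G Mod N) \<rightarrow>\<^sub>E (carrier (G Mod N) \<rightarrow>\<^sub>E {z. z ^ d = 1}).
    projective_rep (G Mod N) d \<alpha> T \<and> irreducible_rep (G Mod N) d T \<and>
    (\<forall>g\<in>carrier G. \<exists>c. c \<noteq> 0 \<and> \<rho> g = c \<cdot>\<^sub>m T (N #>\<^bsub>G\<^esub> g))"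
proof -
  interpret N: normal N G by (rule N)
  interpret F: group "G Mod N" by (rule N.factorgroup_is_group)
  let ?F = "carrier (G Mod N)"
  have d: "d > 0" using irr by (simp add: irreducible_rep_def)
  note \<rho>h = GL_hom[OF N.is_group hom]
  have \<rho>det: "det (\<rho> g) \<noteq> 0" if "g \<in> carrier G" for g
    using hom_in_carrier[OF hom that] by (simp add: GL_field_iff)
  have Fcar: "p \<in> ?F \<longleftrightarrow> (\<exists>g\<in>carrier G. p = N #>\<^bsub>G\<^esub> g)" for p by (auto simp: FactGroup_def RCOSETS_def)
  define s where "s p = (SOME g. g \<in> carrier G \<and> p = N #>\<^bsub>G\<^esub> g)" for p
  have s: "s p \<in> carrier G" "N #>\<^bsub>G\<^esub> s p = p" if "p \<in> ?F" for p
    using someI_ex[of "\<lambda>g. g \<in> carrier G \<and> p = N #>\<^bsub>G\<^esub> g"] that Fcar unfolding s_def by (metis (lifting))+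
  have same_coset: "\<exists>k. k \<noteq> 0 \<and> \<rho> g = k \<cdot>\<^sub>m \<rho> h"
    if gh: "g \<in> carrier G" "h \<in> carrier G" and eq: "N #>\<^bsub>G\<^esub> g = N #>\<^bsub>G\<^esub> h" for g h
  proof -
    have "g \<in> N #>\<^bsub>G\<^esub> h" using N.rcos_self[OF gh(1) N.subgroup_axioms] eq by simp
    then obtain x where x: "x \<in> N" "g = x \<otimes>\<^bsub>G\<^esub> h" unfolding r_coset_def by blast
    obtain k where k: "\<rho> x = k \<cdot>\<^sub>m 1\<^sub>m d" using scalar[OF x(1)] by blast
    have "\<rho> g = \<rho> x * \<rho> h" unfolding x(2) using x(1) gh(2) by (intro \<rho>h(2)) auto
    also have "\<dots> = k \<cdot>\<^sub>m \<rho> h"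
      unfolding k using \<rho>h(1)[OF gh(2)] by (simp add: mult_smult_assoc_mat[of _ d d _ d])
    finally have eq: "\<rho> g = k \<cdot>\<^sub>m \<rho> h" .
    moreover have "k \<noteq> 0"
    proof
      assume "k = 0"
      then have "det (\<rho> g) = 0" using \<rho>h(1)[OF gh(2)] d by (simp add: eq power_0_left)
      then show False using \<rho>det[OF gh(1)] by simp
    qed
    ultimately show ?thesis by blast
  qed
  have "\<exists>c. \<forall>p. c p ^ d = 1 / det (\<rho> (s p))"
    by (intro choice allI complex_root_exists d)
  then obtain c where c: "\<And>p. c p ^ d = 1 / det (\<rho> (s p))" by blast
  define T where "T p = c p \<cdot>\<^sub>m \<rho> (s p)" for p
  have c0: "c p \<noteq> 0" if "p \<in> ?F" for p
    using c[of p] \<rho>det[OF s(1)[OF that]] d by (auto simp: power_0_left)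
  have Tc: "T p \<in> carrier_mat d d" if "p \<in> ?F" for p
    using \<rho>h(1)[OF s(1)[OF that]] by (simp add: T_def)
  have Tdet: "det (T p) = 1" if "p \<in> ?F" for p
    using \<rho>h(1)[OF s(1)[OF that]] \<rho>det[OF s(1)[OF that]] c[of p] by (simp add: T_def)
  have scale: "\<exists>k. k \<noteq> 0 \<and> \<rho> g = k \<cdot>\<^sub>m T (N #>\<^bsub>G\<^esub> g)" if g: "g \<in> carrier G" for g
  proof -
    let ?p = "N #>\<^bsub>G\<^esub> g"
    have p: "?p \<in> ?F" using g Fcar by blast
    obtain k where k: "k \<noteq> 0" "\<rho> g = k \<cdot>\<^sub>m \<rho> (s ?p)"
      using same_coset[OF g s(1)[OF p]] s(2)[OF p] by metis
    have "\<rho> g = (k / c ?p) \<cdot>\<^sub>m T ?p"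
      unfolding k(2) T_def using c0[OF p] by (intro eq_matI) auto
    then show ?thesis using k(1) c0[OF p] by (intro exI[of _ "k / c ?p"]) auto
  qed
  have mult: "\<exists>a. a ^ d = 1 \<and> T p * T q = a \<cdot>\<^sub>m T (p \<otimes>\<^bsub>G Mod N\<^esub> q)" if pq: "p \<in> ?F" "q \<in> ?F" for p q
  proof -
    let ?g = "s p \<otimes>\<^bsub>G\<^esub> s q"
    have g: "?g \<in> carrier G" using s(1) pq by simp
    have coset: "N #>\<^bsub>G\<^esub> ?g = p \<otimes>\<^bsub>G Mod N\<^esub> q"
      using N.rcos_sum[OF s(1)[OF pq(1)] s(1)[OF pq(2)]] s(2) pq by (simp add: FactGroup_def)
    obtain k where k: "\<rho> ?g = k \<cdot>\<^sub>m T (p \<otimes>\<^bsub>G Mod N\<^esub> q)" using scale[OF g] unfolding coset by blast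
    have r: "p \<otimes>\<^bsub>G Mod N\<^esub> q \<in> ?F" using pq by (rule F.m_closed)
    note car = \<rho>h(1)[OF s(1)[OF pq(1)]] \<rho>h(1)[OF s(1)[OF pq(2)]]
    have "T p * T q = (c p * c q) \<cdot>\<^sub>m (\<rho> (s p) * \<rho> (s q))"
      unfolding T_def using car by (intro eq_matI) (auto simp: scalar_prod_def sum_distrib_left mult_ac)
    also have "\<rho> (s p) * \<rho> (s q) = \<rho> ?g" using \<rho>h(2) s(1) pq by simp
    also have "(c p * c q) \<cdot>\<^sub>m \<rho> ?g = (c p * c q * k) \<cdot>\<^sub>m T (p \<otimes>\<^bsub>G Mod N\<^esub> q)"
      unfolding k by (intro eq_matI) auto
    finally have eq: "T p * T q = (c p * c q * k) \<cdot>\<^sub>m T (p \<otimes>\<^bsub>G Mod N\<^esub> q)" .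
    have "1 = det (T p * T q)" using det_mult[OF Tc[OF pq(1)] Tc[OF pq(2)]] Tdet pq by simp
    also have "\<dots> = (c p * c q * k) ^ d" unfolding eq using Tc[OF r] Tdet[OF r] by simp
    finally show ?thesis using eq by metis
  qed
  define \<alpha> where "\<alpha> = restrict (\<lambda>p. restrict (\<lambda>q. SOME a. a ^ d = 1 \<and> T p * T q = a \<cdot>\<^sub>m T (p \<otimes>\<^bsub>G Mod N\<^esub> q)) ?F) ?F"
  have \<alpha>: "\<alpha> p q ^ d = 1 \<and> T p * T q = \<alpha> p q \<cdot>\<^sub>m T (p \<otimes>\<^bsub>G Mod N\<^esub> q)" if pq: "p \<in> ?F" "q \<in> ?F" for p q
    using someI_ex[OF mult[OF pq]] pq by (simp add: \<alpha>_def)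
  have "\<alpha> \<in> ?F \<rightarrow>\<^sub>E (?F \<rightarrow>\<^sub>E {z. z ^ d = 1})"
  proof (rule PiE_I)
    fix p assume p: "p \<in> ?F"
    show "\<alpha> p \<in> ?F \<rightarrow>\<^sub>E {z. z ^ d = 1}"
    proof (rule PiE_I)
      fix q assume "q \<in> ?F" then show "\<alpha> p q \<in> {z. z ^ d = 1}" using \<alpha>[OF p] by simp
    qed (use p in \<open>simp add: \<alpha>_def\<close>)
  qed (simp add: \<alpha>_def)
  moreover have "projective_rep (G Mod N) d \<alpha> T"
    using Tc Tdet \<alpha> by (simp add: projective_rep_def)
  moreover have "irreducible_rep (G Mod N) d T"
    by (rule irreducible_rep_scaled[OF irr _ Tc]) (use scale Fcar in blast)+
  ultimately show ?thesis using scale by blast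
qed

lemma finite_projectively_inequivalent:
  assumes N: "N \<lhd> G" and fin: "finite (carrier (G Mod N))" and d: "d > 0"
    and X: "\<And>\<rho>. \<rho> \<in> X \<Longrightarrow> \<rho> \<in> hom G (GL d)" "\<And>\<rho>. \<rho> \<in> X \<Longrightarrow> irreducible_rep G d \<rho>"
    and scalar: "\<And>\<rho> h. \<rho> \<in> X \<Longrightarrow> h \<in> N \<Longrightarrow> \<exists>k. \<rho> h = k \<cdot>\<^sub>m 1\<^sub>m d"
    and ineq: "\<And>\<rho> \<sigma>. \<rho> \<in> X \<Longrightarrow> \<sigma> \<in> X \<Longrightarrow> projectively_equivalent G d \<rho> \<sigma> \<Longrightarrow> \<rho> = \<sigma>"
  shows "finite X"
proof -
  interpret N: normal N G by (rule N)
  let ?F = "carrier (G Mod N)"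
  let ?A = "?F \<rightarrow>\<^sub>E (?F \<rightarrow>\<^sub>E {z :: complex. z ^ d = 1})"
  define lift where "lift \<alpha> \<rho> T \<longleftrightarrow> projective_rep (G Mod N) d \<alpha> T \<and> irreducible_rep (G Mod N) d T \<and>
    (\<forall>g\<in>carrier G. \<exists>c. c \<noteq> 0 \<and> \<rho> g = c \<cdot>\<^sub>m T (N #>\<^bsub>G\<^esub> g))" for \<alpha> \<rho> T
  define Y where "Y \<alpha> = {\<rho> \<in> X. \<exists>T. lift \<alpha> \<rho> T}" for \<alpha>
  have "finite {z :: complex. z ^ d = 1}" using d by (intro finite_nth_roots)
  then have "finite ?A" using fin by (intro finite_PiE)
  moreover have "finite (Y \<alpha>)" if "\<alpha> \<in> ?A" for \<alpha>
  proof (rule ccontr)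
    assume "infinite (Y \<alpha>)"
    then obtain r :: "nat \<Rightarrow> _" where r: "inj r" "range r \<subseteq> Y \<alpha>"
      using infinite_countable_subset by blast
    have "\<forall>m. \<exists>T. lift \<alpha> (r m) T" using r(2) by (auto simp: Y_def)
    then have "\<exists>T. \<forall>m. lift \<alpha> (r m) (T m)" by (rule choice)
    then obtain T where T: "\<And>m. lift \<alpha> (r m) (T m)" by blast
    have proj: "projective_rep (G Mod N) d \<alpha> (T m)" "irreducible_rep (G Mod N) d (T m)" for m
      using T[of m] by (simp_all add: lift_def)
    have "\<exists>l m P. l < m \<and> m \<le> card ?F \<and> P \<in> carrier_mat d d \<and> det P \<noteq> 0 \<and>
        (\<forall>p\<in>?F. P * T m p = T l p * P)"
      by (rule card_inequivalent_projective_reps[OF N.factorgroup_is_group fin proj])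
    then obtain l m P where lm: "l < m" and P: "P \<in> carrier_mat d d" "det P \<noteq> 0"
      and PT: "\<And>p. p \<in> ?F \<Longrightarrow> P * T m p = T l p * P"
      by (elim exE conjE) (rule that, assumption+, blast)
    have "\<exists>c. P * r m g = c \<cdot>\<^sub>m (r l g * P)" if g: "g \<in> carrier G" for g
    proof -
      let ?p = "N #>\<^bsub>G\<^esub> g"
      have p: "?p \<in> ?F" using g by (auto simp: FactGroup_def RCOSETS_def)
      obtain a b where a: "r m g = a \<cdot>\<^sub>m T m ?p" and b: "b \<noteq> 0" "r l g = b \<cdot>\<^sub>m T l ?p"
        using T[of m] T[of l] g unfolding lift_def by blast
      have Tc: "T m ?p \<in> carrier_mat d d" "T l ?p \<in> carrier_mat d d"
        using proj(1)[of m] proj(1)[of l] p by (auto simp: projective_rep_def)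
      have "P * r m g = a \<cdot>\<^sub>m (T l ?p * P)"
        unfolding a using mult_smult_distrib[OF P(1) Tc(1)] PT[OF p] by simp
      also have "\<dots> = (a / b) \<cdot>\<^sub>m (b \<cdot>\<^sub>m (T l ?p * P))" using b(1) by (intro eq_matI) auto
      also have "b \<cdot>\<^sub>m (T l ?p * P) = r l g * P"
        unfolding b(2) using mult_smult_assoc_mat[OF Tc(2) P(1)] by simp
      finally show ?thesis by blast
    qed
    then have "projectively_equivalent G d (r m) (r l)"
      unfolding projectively_equivalent_def by (intro bexI[of _ P] ballI) (simp_all add: GL_field_iff P)
    moreover have "r m \<in> X" "r l \<in> X" using r(2) by (auto simp: Y_def)
    ultimately have "r m = r l" by (intro ineq)
    then show False using r(1) lm by (auto simp: inj_def)
  qed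
  ultimately have "finite (\<Union>\<alpha>\<in>?A. Y \<alpha>)" by blast
  moreover have "X \<subseteq> (\<Union>\<alpha>\<in>?A. Y \<alpha>)"
  proof
    fix \<rho> assume \<rho>: "\<rho> \<in> X"
    show "\<rho> \<in> (\<Union>\<alpha>\<in>?A. Y \<alpha>)"
      using projective_rep_of_quotient[OF N X(1)[OF \<rho>] X(2)[OF \<rho>] scalar[OF \<rho>]] \<rho>
      unfolding Y_def lift_def by blast
  qed
  ultimately show ?thesis by (rule rev_finite_subset)
qed

lemma GL_hom_det:
  "group G \<Longrightarrow> \<rho> \<in> hom G (GL d) \<Longrightarrow> g \<in> carrier G \<Longrightarrow> det (\<rho> g :: complex mat) \<noteq> 0"
  using hom_in_carrier by (fastforce simp: GL_field_iff)

lemma projectively_equivalent_sym: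
  assumes G: "group G" and hom: "\<rho> \<in> hom G (GL d)" "\<sigma> \<in> hom G (GL d)" and d: "d > 0"
    and eq: "projectively_equivalent G d \<rho> \<sigma>"
  shows "projectively_equivalent G d \<sigma> \<rho>"
proof -
  obtain P where P: "P \<in> carrier (GL d)" "\<And>g. g \<in> carrier G \<Longrightarrow> \<exists>c. P * \<rho> g = c \<cdot>\<^sub>m (\<sigma> g * P)"
    using eq by (auto simp: projectively_equivalent_def)
  obtain Q where Q: "Q \<in> carrier_mat d d" "P * Q = 1\<^sub>m d" "Q * P = 1\<^sub>m d" using P(1) by (auto simp: GL_iff)
  have Pc: "P \<in> carrier_mat d d" by (rule GL_carrier[OF P(1)])
  have "\<exists>c. Q * \<sigma> g = c \<cdot>\<^sub>m (\<rho> g * Q)" if g: "g \<in> carrier G" for g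
  proof -
    obtain c where c: "P * \<rho> g = c \<cdot>\<^sub>m (\<sigma> g * P)" using P(2)[OF g] by blast
    note r = GL_hom(1)[OF G hom(1) g] and s = GL_hom(1)[OF G hom(2) g]
    have "c \<noteq> 0"
    proof
      assume "c = 0"
      then have "det (P * \<rho> g) = 0" unfolding c using s Pc d by (simp add: power_0_left)
      moreover have "det (P * \<rho> g) = det P * det (\<rho> g)" by (rule det_mult[OF Pc r])
      ultimately show False using GL_hom_det[OF G hom(1) g] P(1) by (simp add: GL_field_iff)
    qed
    have "\<rho> g * Q = Q * (P * \<rho> g) * Q"
      using r Q Pc by (simp flip: assoc_mult_mat[of _ d d _ d _ d])
    also have "\<dots> = c \<cdot>\<^sub>m (Q * \<sigma> g * (P * Q))"
      unfolding c using s Q(1) Pc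
      by (simp add: mult_smult_distrib[of _ d d _ d] mult_smult_assoc_mat[of _ d d _ d]
          assoc_mult_mat[of _ d d _ d _ d] mult_carrier_mat[of _ d d _ d])
    also have "\<dots> = c \<cdot>\<^sub>m (Q * \<sigma> g)" using Q s by (simp add: right_mult_one_mat[of _ d d] mult_carrier_mat[of _ d d _ d])
    finally have "Q * \<sigma> g = inverse c \<cdot>\<^sub>m (\<rho> g * Q)" using \<open>c \<noteq> 0\<close> by (intro eq_matI) (auto simp del: index_mult_mat(1))
    then show ?thesis by blast
  qed
  moreover have "Q \<in> carrier (GL d)" using Q Pc by (auto simp: GL_iff)
  ultimately show ?thesis by (auto simp: projectively_equivalent_def)
qed

lemma projectively_equivalent_trans:
  assumes G: "group G" and hom: "\<rho> \<in> hom G (GL d)" "\<sigma> \<in> hom G (GL d)" "\<tau> \<in> hom G (GL d)"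
    and eq: "projectively_equivalent G d \<rho> \<sigma>" "projectively_equivalent G d \<sigma> \<tau>"
  shows "projectively_equivalent G d \<rho> \<tau>"
proof -
  interpret GL: group "GL d :: complex mat monoid" by (rule GL_group)
  obtain P where P: "P \<in> carrier (GL d)" "\<And>g. g \<in> carrier G \<Longrightarrow> \<exists>c. P * \<rho> g = c \<cdot>\<^sub>m (\<sigma> g * P)"
    using eq by (auto simp: projectively_equivalent_def)
  obtain Q where Q: "Q \<in> carrier (GL d)" "\<And>g. g \<in> carrier G \<Longrightarrow> \<exists>c. Q * \<sigma> g = c \<cdot>\<^sub>m (\<tau> g * Q)"
    using eq by (auto simp: projectively_equivalent_def)
  note Pc = GL_carrier[OF P(1)] and Qc = GL_carrier[OF Q(1)]
  have "\<exists>c. (Q * P) * \<rho> g = c \<cdot>\<^sub>m (\<tau> g * (Q * P))" if g: "g \<in> carrier G" for g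
  proof -
    obtain a where a: "P * \<rho> g = a \<cdot>\<^sub>m (\<sigma> g * P)" using P(2)[OF g] by blast
    obtain b where b: "Q * \<sigma> g = b \<cdot>\<^sub>m (\<tau> g * Q)" using Q(2)[OF g] by blast
    note car = GL_hom(1)[OF G hom(1) g] GL_hom(1)[OF G hom(2) g] GL_hom(1)[OF G hom(3) g] Pc Qc
    have "(Q * P) * \<rho> g = Q * (P * \<rho> g)" using car by (simp add: assoc_mult_mat[of _ d d _ d _ d])
    also have "\<dots> = a \<cdot>\<^sub>m ((Q * \<sigma> g) * P)" unfolding a
      using car by (simp add: assoc_mult_mat[of _ d d _ d _ d] mult_smult_distrib[of _ d d _ d] mult_carrier_mat[of _ d d _ d])
    also have "\<dots> = (a * b) \<cdot>\<^sub>m (\<tau> g * (Q * P))" unfolding b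
      using car by (simp add: assoc_mult_mat[of _ d d _ d _ d] mult_smult_assoc_mat[of _ d d _ d] mult_carrier_mat[of _ d d _ d])
        (intro eq_matI, auto simp del: index_mult_mat(1))
    finally show ?thesis by blast
  qed
  moreover have "Q * P \<in> carrier (GL d)" using GL.m_closed[OF Q(1) P(1)] by simp
  ultimately show ?thesis by (auto simp: projectively_equivalent_def)
qed

lemma tensor_rep_one_dimensional:
  assumes "\<sigma> g \<in> carrier_mat d d" "\<chi> g \<in> carrier_mat 1 1"
  shows "tensor_rep \<sigma> \<chi> g = \<chi> g $$ (0, 0) \<cdot>\<^sub>m \<sigma> g"
  using assms by (intro eq_matI) (auto simp: tensor_rep_def kronecker_product_def)

lemma twist_equivalent_imp_projectively_equivalent:
  assumes G: "group G" and hom: "\<sigma> \<in> hom G (GL d)" and eq: "twist_equivalent G T d \<rho> \<sigma>"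
  shows "projectively_equivalent G d \<rho> \<sigma>"
proof -
  obtain \<chi> P where \<chi>: "continuous_rep G T 1 \<chi>" and P: "P \<in> carrier (GL d)"
    "\<And>g. g \<in> carrier G \<Longrightarrow> P * \<rho> g = tensor_rep \<sigma> \<chi> g * P"
    using eq by (auto simp: twist_equivalent_def rep_iso_def)
  have \<chi>h: "\<chi> \<in> hom G (GL 1)" using \<chi> by (simp add: continuous_rep_def)
  have "P * \<rho> g = \<chi> g $$ (0, 0) \<cdot>\<^sub>m (\<sigma> g * P)" if g: "g \<in> carrier G" for g
  proof -
    note s = GL_hom(1)[OF G hom g] and c = GL_hom(1)[OF G \<chi>h g]
    show ?thesis unfolding P(2)[OF g] tensor_rep_one_dimensional[of \<sigma> g d \<chi>, OF s c]
      by (rule mult_smult_assoc_mat[OF s GL_carrier[OF P(1)]])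
  qed
  then show ?thesis using P(1) by (auto simp: projectively_equivalent_def)
qed

text \<open>The scalars \<open>c g\<close> are unique, hence multiplicative in \<open>g\<close>, and they are constant on the cosets of a
  congruence subgroup on which both representations are trivial; so they form a continuous character.\<close>

lemma projectively_equivalent_imp_twist_equivalent:
  fixes \<pi> :: "'a :: idom"
  assumes pow: "\<And>k. ideal_power class_ring (max_ideal class_ring) k = {x :: 'a. \<pi> ^ k dvd x}"
    and \<rho>: "continuous_rep (GL n :: 'a mat monoid) (GL_topology n) d \<rho>"
    and \<sigma>: "continuous_rep (GL n :: 'a mat monoid) (GL_topology n) d \<sigma>" and d: "d > 0"
    and eq: "projectively_equivalent (GL n :: 'a mat monoid) d \<rho> \<sigma>"
  shows "twist_equivalent (GL n :: 'a mat monoid) (GL_topology n) d \<rho> \<sigma>"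
proof -
  let ?G = "GL n :: 'a mat monoid"
  interpret G: group ?G by (rule GL_group)
  have hom: "\<rho> \<in> hom ?G (GL d)" "\<sigma> \<in> hom ?G (GL d)" using \<rho> \<sigma> by (auto simp: continuous_rep_def)
  note \<rho>h = GL_hom[OF G.is_group hom(1)] and \<sigma>h = GL_hom[OF G.is_group hom(2)]
  obtain P where P: "P \<in> carrier (GL d)" "\<And>g. g \<in> carrier ?G \<Longrightarrow> \<exists>c. P * \<rho> g = c \<cdot>\<^sub>m (\<sigma> g * P)"
    using eq by (auto simp: projectively_equivalent_def)
  obtain c where c: "\<And>g. g \<in> carrier ?G \<Longrightarrow> P * \<rho> g = c g \<cdot>\<^sub>m (\<sigma> g * P)" using P(2) by metis
  have Pc: "P \<in> carrier_mat d d" and Pdet: "det P \<noteq> 0" using P(1) by (auto simp: GL_field_iff)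
  have unique: "x = y" if g: "g \<in> carrier ?G" and xy: "x \<cdot>\<^sub>m (\<sigma> g * P) = y \<cdot>\<^sub>m (\<sigma> g * P)" for x y g
  proof (rule smult_mat_cancel[OF xy _ _ d])
    show "\<sigma> g * P \<in> carrier_mat d d" using \<sigma>h(1)[OF g] Pc by auto
    show "det (\<sigma> g * P) \<noteq> 0"
      using det_mult[OF \<sigma>h(1)[OF g] Pc] Pdet GL_hom_det[OF G.is_group hom(2) g] by simp
  qed
  have cmult: "c (g * h) = c g * c h" if gh: "g \<in> carrier ?G" "h \<in> carrier ?G" for g h
  proof -
    have g_h: "g * h \<in> carrier ?G" using G.m_closed[OF gh] by simp
    note car = \<rho>h(1)[OF gh(1)] \<rho>h(1)[OF gh(2)] \<sigma>h(1)[OF gh(1)] \<sigma>h(1)[OF gh(2)] Pc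
    have "c (g * h) \<cdot>\<^sub>m (\<sigma> (g * h) * P) = P * (\<rho> g * \<rho> h)"
      using c[OF g_h] \<rho>h(2)[OF gh] by simp
    also have "\<dots> = (P * \<rho> g) * \<rho> h" using car by (simp add: assoc_mult_mat[of _ d d _ d _ d])
    also have "\<dots> = c g \<cdot>\<^sub>m (\<sigma> g * (P * \<rho> h))" unfolding c[OF gh(1)]
      using car by (simp add: assoc_mult_mat[of _ d d _ d _ d] mult_smult_assoc_mat[of _ d d _ d] mult_carrier_mat[of _ d d _ d])
    also have "\<dots> = (c g * c h) \<cdot>\<^sub>m (\<sigma> g * (\<sigma> h * P))" unfolding c[OF gh(2)]
      using car by (simp add: mult_smult_distrib[of _ d d _ d] mult_carrier_mat[of _ d d _ d])
        (intro eq_matI, auto simp del: index_mult_mat(1))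
    also have "\<sigma> g * (\<sigma> h * P) = \<sigma> (g * h) * P"
      using \<sigma>h(2)[OF gh] car by (simp add: assoc_mult_mat[of _ d d _ d _ d])
    finally show ?thesis by (rule unique[OF g_h])
  qed
  have c1: "c h = 1" if h: "h \<in> carrier ?G" and triv: "\<rho> h = 1\<^sub>m d" "\<sigma> h = 1\<^sub>m d" for h
  proof (rule unique[OF h])
    have "c h \<cdot>\<^sub>m (\<sigma> h * P) = P" using c[OF h] triv Pc by simp
    then show "c h \<cdot>\<^sub>m (\<sigma> h * P) = 1 \<cdot>\<^sub>m (\<sigma> h * P)" using triv Pc by (intro eq_matI) auto
  qed
  have c0: "c g \<noteq> 0" if g: "g \<in> carrier ?G" for g
  proof -
    have "c (g * inv\<^bsub>?G\<^esub> g) = 1"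
      using GL_inv(2)[OF g] c1[OF G.one_closed \<rho>h(3) \<sigma>h(3)] by simp
    then show ?thesis using cmult[OF g G.inv_closed[OF g]] by auto
  qed
  define \<chi> where "\<chi> g = mat 1 1 (\<lambda>_. c g)" for g
  have \<chi>c: "\<chi> g \<in> carrier_mat 1 1" for g by (simp add: \<chi>_def)
  have \<chi>hom: "\<chi> \<in> hom ?G (GL 1)"
  proof (rule homI)
    fix g assume g: "g \<in> carrier ?G"
    have "det (\<chi> g) = c g" by (subst det_single) (simp_all add: \<chi>_def)
    then show "\<chi> g \<in> carrier (GL 1)" using c0[OF g] \<chi>c by (simp add: GL_field_iff)
  next
    fix g h assume "g \<in> carrier ?G" "h \<in> carrier ?G"
    then show "\<chi> (g \<otimes>\<^bsub>?G\<^esub> h) = \<chi> g \<otimes>\<^bsub>GL 1\<^esub> \<chi> h"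
      by (auto simp: \<chi>_def cmult scalar_prod_def intro!: eq_matI)
  qed
  obtain k l where k: "\<And>h. h \<in> level_subgroup n (\<pi> ^ k) \<Longrightarrow> \<rho> h = 1\<^sub>m d"
    and l: "\<And>h. h \<in> level_subgroup n (\<pi> ^ l) \<Longrightarrow> \<sigma> h = 1\<^sub>m d"
    using continuous_rep_open_kernel[OF pow \<rho> d] continuous_rep_open_kernel[OF pow \<sigma> d] by blast
  define m where "m = max k l"
  have sub: "level_subgroup n (\<pi> ^ m) \<subseteq> level_subgroup n (\<pi> ^ k)"
    "level_subgroup n (\<pi> ^ m) \<subseteq> level_subgroup n (\<pi> ^ l)"
    by (intro level_subgroup_mono le_imp_power_dvd; simp add: m_def)+
  have c_const: "c (g * h) = c g" if g: "g \<in> carrier ?G" and h: "h \<in> level_subgroup n (\<pi> ^ m)" for g h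
  proof -
    have "c h = 1" using h sub k l by (intro c1 level_subgroup_GL[OF h]) auto
    then show ?thesis using cmult[OF g level_subgroup_GL[OF h]] by simp
  qed
  have cont: "continuous_map (GL_topology n) euclidean (\<lambda>g. \<chi> g $$ (i, j))" if "i < 1" "j < 1" for i j
  proof -
    have eq: "(\<lambda>g. \<chi> g $$ (i, j)) = c" using that by (simp add: \<chi>_def)
    show ?thesis unfolding eq continuous_map_def
    proof (intro conjI allI impI)
      show "c \<in> topspace (GL_topology n) \<rightarrow> topspace euclidean" by simp
      fix V :: "complex set" 
      show "openin (GL_topology n) {g \<in> topspace (GL_topology n). c g \<in> V}"
      proof (rule openin_GL_topology_if_contains_cosets[OF pow, of _ n m])
        show "{g \<in> topspace (GL_topology n). c g \<in> V} \<subseteq> carrier ?G" by (auto simp: topspace_GL_topology)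
        fix g assume g: "g \<in> {g \<in> topspace (GL_topology n). c g \<in> V}"
        then have gG: "g \<in> carrier ?G" by (simp add: topspace_GL_topology)
        show "g <#\<^bsub>?G\<^esub> level_subgroup n (\<pi> ^ m) \<subseteq> {g \<in> topspace (GL_topology n). c g \<in> V}"
        proof
          fix y assume "y \<in> g <#\<^bsub>?G\<^esub> level_subgroup n (\<pi> ^ m)"
          then obtain h where h: "h \<in> level_subgroup n (\<pi> ^ m)" "y = g * h" by (auto simp: l_coset_def)
          have "y \<in> carrier ?G" using G.m_closed[OF gG level_subgroup_GL[OF h(1)]] h(2) by simp
          then show "y \<in> {g \<in> topspace (GL_topology n). c g \<in> V}"
            using c_const[OF gG h(1)] g h(2) by (simp add: topspace_GL_topology)
        qed
      qed
    qed
  qed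
  have "rep_iso ?G d \<rho> (tensor_rep \<sigma> \<chi>)"
    unfolding rep_iso_def
  proof (intro bexI[OF _ P(1)] ballI)
    fix g assume g: "g \<in> carrier ?G"
    have "tensor_rep \<sigma> \<chi> g * P = c g \<cdot>\<^sub>m (\<sigma> g * P)"
      unfolding tensor_rep_one_dimensional[of \<sigma> g d \<chi>, OF \<sigma>h(1)[OF g] \<chi>c]
      using mult_smult_assoc_mat[OF \<sigma>h(1)[OF g] Pc] by (simp add: \<chi>_def)
    then show "P * \<rho> g = tensor_rep \<sigma> \<chi> g * P" using c[OF g] by simp
  qed
  moreover have "continuous_rep ?G (GL_topology n) 1 \<chi>"
    using \<chi>hom cont by (simp add: continuous_rep_def)
  ultimately show ?thesis unfolding twist_equivalent_def by blast
qed

lemma finite_quotient_if_inequivalent_finite: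
  assumes eq: "sym R" "trans R"
    and fin: "\<And>X. X \<subseteq> A \<Longrightarrow> (\<And>x y. x \<in> X \<Longrightarrow> y \<in> X \<Longrightarrow> (x, y) \<in> R \<Longrightarrow> x = y) \<Longrightarrow> finite X"
  shows "finite (A // R)"
proof -
  define s where "s C = (SOME x. x \<in> A \<and> C = R `` {x})" for C
  have s: "s C \<in> A" "R `` {s C} = C" if "C \<in> A // R" for C
  proof -
    have "\<exists>x. x \<in> A \<and> C = R `` {x}" using that by (auto elim: quotientE)
    from someI_ex[OF this] show "s C \<in> A" "R `` {s C} = C" unfolding s_def by auto
  qed
  have "finite (s ` (A // R))"
  proof (rule fin)
    show "s ` (A // R) \<subseteq> A" using s by auto
    fix x y assume "x \<in> s ` (A // R)" "y \<in> s ` (A // R)" and xy: "(x, y) \<in> R"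
    then obtain C D where C: "C \<in> A // R" "x = s C" and D: "D \<in> A // R" "y = s D" by auto
    have "R `` {x} = R `` {y}" using xy eq by (auto dest: symD transD)
    then show "x = y" using s C D by metis
  qed
  moreover have "inj_on s (A // R)" using s by (metis inj_onI)
  ultimately show ?thesis by (rule finite_imageD)
qed

section \<open>Finiteness of the number of twist isoclasses\<close>

theorem lemma3p1:
  fixes n d :: nat
  assumes "complete_discrete_valuation_ring (class_ring :: 'a :: idom ring)"
    and "finite (carrier ((class_ring :: 'a ring) Quot max_ideal class_ring))"
    and "n \<ge> 1" and "d \<ge> 1"
  shows "finite (twist_isoclasses (GL n :: 'a mat monoid) (GL_topology n) d)"
proof -
  let ?G = "GL n :: 'a mat monoid"
  let ?T = "GL_topology n :: 'a mat topology"
  let ?A = "continuous_irreps ?G ?T d"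
  have d: "d > 0" using assms(4) by simp
  interpret G: group ?G by (rule GL_group)
  obtain \<pi> :: 'a where "local_uniformizer \<pi>"
    and pow: "\<And>k. ideal_power class_ring (max_ideal class_ring) k = {x :: 'a. \<pi> ^ k dvd x}"
    using complete_dvr_uniformizer[OF assms(1,2)] by metis
  interpret local_uniformizer \<pi> by fact
  have A: "continuous_rep ?G ?T d \<rho>" "\<rho> \<in> hom ?G (GL d)" "irreducible_rep ?G d \<rho>" if "\<rho> \<in> ?A" for \<rho>
    using that by (auto simp: continuous_irreps_def continuous_rep_def)
  have twist_iff: "twist_equivalent ?G ?T d \<rho> \<sigma> \<longleftrightarrow> projectively_equivalent ?G d \<rho> \<sigma>"
    if "\<rho> \<in> ?A" "\<sigma> \<in> ?A" for \<rho> \<sigma>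
    using twist_equivalent_imp_projectively_equivalent[OF G.is_group A(2)[OF that(2)]]
      projectively_equivalent_imp_twist_equivalent[OF pow A(1)[OF that(1)] A(1)[OF that(2)] d] by blast
  define R where "R = {(\<rho>, \<sigma>). \<rho> \<in> ?A \<and> \<sigma> \<in> ?A \<and> twist_equivalent ?G ?T d \<rho> \<sigma>}"
  have R_iff: "(\<rho>, \<sigma>) \<in> R \<longleftrightarrow> \<rho> \<in> ?A \<and> \<sigma> \<in> ?A \<and> projectively_equivalent ?G d \<rho> \<sigma>" for \<rho> \<sigma>
    using twist_iff by (auto simp: R_def)
  obtain u v :: 'a where uv: "u * v = 1" "u ^ fact d \<noteq> 1"
    using unit_of_large_order[of "fact d"] by (auto simp: fact_gt_zero)
  \<comment> \<open>The element \<open>e\<close> depends on \<open>d\<close> but not on a representation.\<close>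
  define e where "e = u ^ fact d - 1"
  have e: "e \<noteq> 0" using uv by (simp add: e_def)
  have scalar: "\<exists>k. \<rho> h = k \<cdot>\<^sub>m 1\<^sub>m d" if \<rho>: "\<rho> \<in> ?A" and h: "h \<in> level_subgroup n e" for \<rho> h
  proof -
    note hom = A(2)[OF \<rho>]
    obtain k where k: "\<And>h. h \<in> level_subgroup n (\<pi> ^ k) \<Longrightarrow> \<rho> h = 1\<^sub>m d"
      using continuous_rep_open_kernel[OF pow A(1)[OF \<rho>] d] by blast
    have ker: "\<rho> (addrow_mat n (e * c) a b) = 1\<^sub>m d" if "a < n" "b < n" "a \<noteq> b" for a b c
      unfolding e_def by (rule elementary_kernel[OF hom k uv(1) that])
    show ?thesis
    proof (rule schur_scalar[OF A(3)[OF \<rho>]])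
      show "\<rho> g \<in> carrier_mat d d" if "g \<in> carrier ?G" for g by (rule GL_hom(1)[OF G.is_group hom that])
      then show "\<rho> h \<in> carrier_mat d d" using level_subgroup_GL[OF h] .
      show "\<rho> h * \<rho> g = \<rho> g * \<rho> h" if "g \<in> carrier ?G" for g
        by (rule level_subgroup_central[OF hom ker h that])
    qed
  qed
  obtain Q where Q: "finite Q" "\<And>x. \<exists>r\<in>Q. e dvd x - r" using finite_residues_nonzero[OF e] by auto
  have "finite (?A // R)"
  proof (rule finite_quotient_if_inequivalent_finite)
    show "sym R"
      using projectively_equivalent_sym[OF G.is_group A(2) A(2) d] by (intro symI) (auto simp: R_iff)
    show "trans R"
      using projectively_equivalent_trans[OF G.is_group A(2) A(2) A(2)] by (intro transI) (auto simp: R_iff)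
    fix X assume X: "X \<subseteq> ?A" and ineq: "\<And>\<rho> \<sigma>. \<rho> \<in> X \<Longrightarrow> \<sigma> \<in> X \<Longrightarrow> (\<rho>, \<sigma>) \<in> R \<Longrightarrow> \<rho> = \<sigma>"
    show "finite X"
    proof (rule finite_projectively_inequivalent[OF level_subgroup_normal finite_level_cosets[OF Q] d])
      show "\<rho> \<in> hom ?G (GL d)" "irreducible_rep ?G d \<rho>" if "\<rho> \<in> X" for \<rho> using A X that by auto
      show "\<exists>k. \<rho> h = k \<cdot>\<^sub>m 1\<^sub>m d" if "\<rho> \<in> X" "h \<in> level_subgroup n e" for \<rho> h using scalar X that by auto
      show "\<rho> = \<sigma>" if "\<rho> \<in> X" "\<sigma> \<in> X" "projectively_equivalent ?G d \<rho> \<sigma>" for \<rho> \<sigma>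
        using ineq[OF that(1,2)] X that by (auto simp: R_iff)
    qed
  qed
  then show ?thesis by (simp add: twist_isoclasses_def R_def)
qed

end
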